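(* Let $\mathbf{\Xi}=(\boldsymbol{\xi}^{(1)},\dots,\boldsymbol{\xi}^{(m)})$ be an $m$-segment knot vector configuration and $\mathbf{W}=(\mathbf{w}^{(1)},\dots,\mathbf{w}^{(m)})$ a sequence of weight vectors, as described in the context. Let $\{B_i : i=1,\dots,n\}$ and $\{B_i^{per} : i=1,\dots,n^{per}\}$ be the functions on $\Omega$ defined by $\mathbf{B}=\mathbf{H}\mathbf{b}$ and $\mathbf{B}^{per}=\mathbf{H}^{per}\mathbf{b}$. Then $B_1,\dots,B_n$ are $C^1$ smooth piecewise-rational functions (elements of $\mathcal{R}[\mathbf{\Xi},\mathbf{W}]$), and $B_1^{per},\dots,B_{n^{per}}^{per}$ are $C^1$ smooth periodic piecewise-rational functions (elements of $\mathcal{R}^{per}[\mathbf{\Xi},\mathbf{W}]$). Moreover, each of the two sets $\{B_i : i=1,\dots,n\}$ and $\{B_i^{per} : i=1,\dots,n^{per}\}$ is linearly independent, consists of locally supported functions, and forms a convex partition of unity on $\Omega$.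
   Context: **NURBS.** An open knot vector of degree $p\in\mathbb{N}$, $p\ge 2$, on an interval $I=[x_1,x_2]$ ($x_1<x_2$) is $\boldsymbol{\xi}=[\xi_1,\dots,\xi_{n+p+1}]$ with $\xi_{i+1}\ge\xi_i$, $\xi_1=\dots=\xi_{p+1}=x_1<\xi_{p+2}$ and $\xi_n<\xi_{n+1}=\dots=\xi_{n+p+1}=x_2$, where each interior knot has multiplicity between $1$ and $p-1$. B-splines are defined by $b_{j,0}(x)=1$ if $\xi_j\le x<\xi_{j+1}$ and $0$ otherwise, and $$b_{j,q}(x)=\frac{x-\xi_j}{\xi_{j+q}-\xi_j}b_{j,q-1}(x)+\frac{\xi_{j+q+1}-x}{\xi_{j+q+1}-\xi_{j+1}}b_{j+1,q-1}(x),$$ where fractions with zero denominator are $0$, and B-splines are taken left continuous at $x_2$. For a weight vector $\mathbf{w}=[w_1,\dots,w_n]$ with all $w_i>0$, the NURBS are $b^w_{j,p}=w_jb_{j,p}/\sum_{i=1}^n w_ib_{i,p}$, $j=1,\dots,n$, and $\mathcal{R}[\boldsymbol{\xi},\mathbf{w}]$ is their span. **Multi-degree splines.** For $i=1,\dots,m$, let $\boldsymbol{\xi}^{(i)}=[\xi^{(i)}_1,\dots,\xi^{(i)}_{n^{(i)}+p^{(i)}+1}]$ be an open knot vector of degree $p^{(i)}\ge2$ on the interval $[x_1^{(i)},x_2^{(i)}]$ ($x_1^{(i)}<x_2^{(i)}$), with $n^{(i)}$ B-splines, that is, $\boldsymbol{\xi}^{(i)}$ is non-decreasing with $\xi^{(i)}_1=\dots=\xi^{(i)}_{p^{(i)}+1}=x_1^{(i)}<\xi^{(i)}_{p^{(i)}+2}$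 and $\xi^{(i)}_{n^{(i)}}<\xi^{(i)}_{n^{(i)}+1}=\dots=\xi^{(i)}_{n^{(i)}+p^{(i)}+1}=x_2^{(i)}$, and each interior knot has multiplicity between $1$ and $p^{(i)}-1$; and let $\mathbf{w}^{(i)}$ be a weight vector of length $n^{(i)}$ (all entries positive). Fix $\tau_1^{(1)}\in\mathbb{R}$ and set $\phi^{(i)}(x)=x-x_1^{(i)}+\tau_1^{(1)}+\sum_{\ell=1}^{i-1}(x_2^{(\ell)}-x_1^{(\ell)})$, $[\tau_1^{(i)},\tau_2^{(i)}]=\phi^{(i)}([x_1^{(i)},x_2^{(i)}])$, and $\Omega=[t_1,t_2]=\bigcup_{i=1}^m[\tau_1^{(i)},\tau_2^{(i)}]$. Define $$\mathcal{R}[\mathbf{\Xi},\mathbf{W}]=\{f\in C^1(\Omega): f\circ\phi^{(i)}\in\mathcal{R}[\boldsymbol{\xi}^{(i)},\mathbf{w}^{(i)}],\ 1\le i\le m\},$$ $$\mathcal{R}^{per}[\mathbf{\Xi},\mathbf{W}]=\{f\in\mathcal{R}[\mathbf{\Xi},\mathbf{W}]: f(t_1)=f(t_2),\ f'(t_1)=f'(t_2)\}.$$ **Local basis.** Let $\mu_0=0$, $\mu_i=\sum_{\ell=1}^i n^{(\ell)}$. For $i=1,\dots,m$, $j=1,\dots,n^{(i)}$, let $b_{\mu_{i-1}+j}(t)$ be equal to the $j$-th NURBS of $(\boldsymbol{\xi}^{(i)},\mathbf{w}^{(i)})$ evaluated at $x$ if $t=\phi^{(i)}(x)\in[\tau_1^{(i)},\tau_2^{(i)})$,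 or if $i=m$ and $t=t_2$ (with $x=x_2^{(m)}$), and $0$ otherwise. Let $\mathbf{b}$ be the column vector of $b_1,\dots,b_{\mu_m}$. **Extraction matrices.** Let $\eta_0=0$, $\eta_i=\mu_i-2i$. For $i=1,\dots,m-1$, and also for $i=m$ with the index $i+1$ identified with $1$, let $$\alpha^{(i)}=\frac{p^{(i)}}{x_2^{(i)}-\xi^{(i)}_{n^{(i)}}}\frac{w^{(i)}_{n^{(i)}-1}}{w^{(i)}_{n^{(i)}}},\qquad \beta^{(i)}=\frac{p^{(i+1)}}{\xi^{(i+1)}_{p^{(i+1)}+2}-x_1^{(i+1)}}\frac{w^{(i+1)}_2}{w^{(i+1)}_1}.$$ Let $\mathbf{H}^c$ be the $\eta_m\times(\mu_m-2)$ matrix whose only non-zero entries are: $H^c_{\eta_{i-1}+j,\,\mu_{i-1}+j}=1$ for $i=1,\dots,m$, $j=1,\dots,n^{(i)}-2$; and for $i=1,\dots,m-1$, $$H^c_{\eta_i,\mu_i-1}=H^c_{\eta_i,\mu_i}=\frac{\alpha^{(i)}}{\alpha^{(i)}+\beta^{(i)}},\qquad H^c_{\eta_i+1,\mu_i-1}=H^c_{\eta_i+1,\mu_i}=\frac{\beta^{(i)}}{\alpha^{(i)}+\beta^{(i)}}.$$ Let $\mathbf{H}$ be the block-diagonal matrix $\mathrm{diag}(1,\mathbf{H}^c,1)$, of size $n\times\mu_m$ with $n=\eta_m+2$. Let $\mathbf{H}^{per}=[\mathbf{h}\,|\,\mathbf{H}^c\,|\,\mathbf{h}]$, of size $n^{per}\times\mu_m$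 with $n^{per}=\eta_m$, where the column $\mathbf{h}$ has top entry $\beta^{(m)}/(\alpha^{(m)}+\beta^{(m)})$, bottom entry $\alpha^{(m)}/(\alpha^{(m)}+\beta^{(m)})$ and zeros elsewhere (if $\eta_m=1$ the two entries are added, giving the single entry $1$). **Terminology.** "Convex partition of unity on $\Omega$" means that the functions are non-negative on $\Omega$ and sum to $1$ at every point of $\Omega$. "Locally supported" means that the $i$-th function vanishes outside the union of the supports of those $b_j$ for which the $(i,j)$ entry of the (sparse) matrix $\mathbf{H}$ (respectively $\mathbf{H}^{per}$) is non-zero. *)

theory Defs
  imports "HOL-Analysis.Analysis"
begin

text \<open>
  Finite sequences and matrices of varying size are functions on \<open>nat\<close> with indices starting at 1,
  as in the mathematics; only the entries inside the stated index ranges are ever used.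
\<close>

definition open_knot_vector :: "nat \<Rightarrow> nat \<Rightarrow> (nat \<Rightarrow> real) \<Rightarrow> real \<Rightarrow> real \<Rightarrow> bool" where
  "open_knot_vector p n \<xi> a b \<longleftrightarrow>
     (\<forall>i\<in>{1..n+p}. \<xi> i \<le> \<xi> (i+1)) \<and>
     (\<forall>i\<in>{1..p+1}. \<xi> i = a) \<and> a < \<xi> (p+2) \<and>
     \<xi> n < b \<and> (\<forall>i\<in>{n+1..n+p+1}. \<xi> i = b) \<and>
     (\<forall>i\<in>{1..n+p+1}. a < \<xi> i \<and> \<xi> i < b \<longrightarrow>
        card {j\<in>{1..n+p+1}. \<xi> j = \<xi> i} \<in> {1..p-1})"

text \<open>Fractions with zero denominator are zero, by the convention for division in HOL.\<close>

fun bspline_rec :: "(nat \<Rightarrow> real) \<Rightarrow> nat \<Rightarrow> nat \<Rightarrow> real \<Rightarrow> real" where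
  "bspline_rec \<xi> 0 j x = (if \<xi> j \<le> x \<and> x < \<xi> (j+1) then 1 else 0)"
| "bspline_rec \<xi> (Suc q) j x =
     (x - \<xi> j) / (\<xi> (j + Suc q) - \<xi> j) * bspline_rec \<xi> q j x +
     (\<xi> (j + Suc q + 1) - x) / (\<xi> (j + Suc q + 1) - \<xi> (j+1)) * bspline_rec \<xi> q (j+1) x"

text \<open>The right end point \<open>b\<close> of the interval needs special care: the recursion gives zero there.\<close>

definition bspline :: "(nat \<Rightarrow> real) \<Rightarrow> real \<Rightarrow> nat \<Rightarrow> nat \<Rightarrow> real \<Rightarrow> real" where
  "bspline \<xi> b p j x =
     (if x = b then Lim (at_left b) (bspline_rec \<xi> p j) else bspline_rec \<xi> p j x)"

record segment =
  deg :: nat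
  nspl :: nat
  lo :: real
  hi :: real
  knot :: "nat \<Rightarrow> real"
  weight :: "nat \<Rightarrow> real"

definition valid_segment :: "segment \<Rightarrow> bool" where
  "valid_segment s \<longleftrightarrow> deg s \<ge> 2 \<and> lo s < hi s \<and>
     open_knot_vector (deg s) (nspl s) (knot s) (lo s) (hi s) \<and>
     (\<forall>j\<in>{1..nspl s}. weight s j > 0)"

definition nurbs :: "segment \<Rightarrow> nat \<Rightarrow> real \<Rightarrow> real" where
  "nurbs s j x = weight s j * bspline (knot s) (hi s) (deg s) j x /
     (\<Sum>i=1..nspl s. weight s i * bspline (knot s) (hi s) (deg s) i x)"

text \<open>The span of the NURBS as functions on \<open>[lo s, hi s]\<close>; values elsewhere are irrelevant.\<close>

definition nurbs_space :: "segment \<Rightarrow> (real \<Rightarrow> real) set" where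
  "nurbs_space s =
     {g. \<exists>c::nat \<Rightarrow> real. \<forall>x\<in>{lo s..hi s}. g x = (\<Sum>j=1..nspl s. c j * nurbs s j x)}"

text \<open>
  A configuration consists of \<open>m\<close> segments \<open>S 1, \<dots>, S m\<close> and the starting point \<open>\<tau>\<close> of \<open>\<Omega>\<close>.
\<close>

definition phi :: "(nat \<Rightarrow> segment) \<Rightarrow> real \<Rightarrow> nat \<Rightarrow> real \<Rightarrow> real" where
  "phi S \<tau> i x = x - lo (S i) + \<tau> + (\<Sum>l=1..<i. hi (S l) - lo (S l))"

definition tau1 :: "(nat \<Rightarrow> segment) \<Rightarrow> real \<Rightarrow> nat \<Rightarrow> real" where
  "tau1 S \<tau> i = phi S \<tau> i (lo (S i))"

definition tau2 :: "(nat \<Rightarrow> segment) \<Rightarrow> real \<Rightarrow> nat \<Rightarrow> real" where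
  "tau2 S \<tau> i = phi S \<tau> i (hi (S i))"

definition Omega :: "nat \<Rightarrow> (nat \<Rightarrow> segment) \<Rightarrow> real \<Rightarrow> real set" where
  "Omega m S \<tau> = (\<Union>i\<in>{1..m}. {tau1 S \<tau> i..tau2 S \<tau> i})"

definition t_start :: "(nat \<Rightarrow> segment) \<Rightarrow> real \<Rightarrow> real" where
  "t_start S \<tau> = tau1 S \<tau> 1"

definition t_end :: "nat \<Rightarrow> (nat \<Rightarrow> segment) \<Rightarrow> real \<Rightarrow> real" where
  "t_end m S \<tau> = tau2 S \<tau> m"

lemma tau1_Suc: "i \<ge> 1 \<Longrightarrow> tau1 S \<tau> (Suc i) = tau2 S \<tau> i"
  by (simp add: tau1_def tau2_def phi_def)

lemma Omega_eq:
  assumes "m \<ge> 1" "\<forall>i\<in>{1..m}. valid_segment (S i)"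
  shows "Omega m S \<tau> = {t_start S \<tau>..t_end m S \<tau>}"
  using assms
proof (induction m rule: nat_induct_at_least)
  case base
  then show ?case by (simp add: Omega_def t_start_def t_end_def)
next
  case (Suc m)
  have le: "tau1 S \<tau> i \<le> tau2 S \<tau> i" if "i \<in> {1..Suc m}" for i
    using Suc.prems that by (auto simp: tau1_def tau2_def phi_def valid_segment_def less_imp_le)
  have IH: "Omega m S \<tau> = {t_start S \<tau>..t_end m S \<tau>}"
    using Suc by simp
  have "tau1 S \<tau> 1 \<le> tau2 S \<tau> 1" using le[of 1] by simp
  moreover have "tau1 S \<tau> 1 \<in> Omega m S \<tau>"
    using calculation Suc.hyps by (auto simp: Omega_def)
  ultimately have "t_start S \<tau> \<le> t_end m S \<tau>"
    using IH by (simp add: t_start_def)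
  moreover have "Omega (Suc m) S \<tau> = Omega m S \<tau> \<union> {tau1 S \<tau> (Suc m)..tau2 S \<tau> (Suc m)}"
    by (auto simp: Omega_def atLeastAtMostSuc_conv)
  ultimately show ?case
    using IH le[of "Suc m"] tau1_Suc[OF Suc.hyps, of S \<tau>]
    by (auto simp: t_end_def)
qed

text \<open>Derivatives at the end points of \<open>A\<close> are one-sided.\<close>

definition C1_on :: "real set \<Rightarrow> (real \<Rightarrow> real) set" where
  "C1_on A = {f. f differentiable_on A \<and>
                 continuous_on A (\<lambda>t. vector_derivative f (at t within A))}"

definition spline_space :: "nat \<Rightarrow> (nat \<Rightarrow> segment) \<Rightarrow> real \<Rightarrow> (real \<Rightarrow> real) set" where
  "spline_space m S \<tau> =
     {f \<in> C1_on (Omega m S \<tau>). \<forall>i\<in>{1..m}. f \<circ> phi S \<tau> i \<in> nurbs_space (S i)}"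

definition per_spline_space :: "nat \<Rightarrow> (nat \<Rightarrow> segment) \<Rightarrow> real \<Rightarrow> (real \<Rightarrow> real) set" where
  "per_spline_space m S \<tau> =
     {f \<in> spline_space m S \<tau>.
        f (t_start S \<tau>) = f (t_end m S \<tau>) \<and>
        vector_derivative f (at (t_start S \<tau>) within Omega m S \<tau>) =
        vector_derivative f (at (t_end m S \<tau>) within Omega m S \<tau>)}"

definition mu :: "(nat \<Rightarrow> segment) \<Rightarrow> nat \<Rightarrow> nat" where
  "mu S i = (\<Sum>l=1..i. nspl (S l))"

definition seg_nurbs :: "nat \<Rightarrow> (nat \<Rightarrow> segment) \<Rightarrow> real \<Rightarrow> nat \<Rightarrow> nat \<Rightarrow> real \<Rightarrow> real" where
  "seg_nurbs m S \<tau> i j t =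
     (if t \<in> {tau1 S \<tau> i..<tau2 S \<tau> i} \<or> (i = m \<and> t = t_end m S \<tau>)
      then nurbs (S i) j (inv (phi S \<tau> i) t) else 0)"

text \<open>The segment \<open>i\<close> with \<open>mu S (i-1) < k \<le> mu S i\<close>; see \<open>local_basis_eq\<close> for the resulting indexing.\<close>

definition seg_of :: "(nat \<Rightarrow> segment) \<Rightarrow> nat \<Rightarrow> nat" where
  "seg_of S k = (LEAST i. k \<le> mu S i)"

definition local_basis :: "nat \<Rightarrow> (nat \<Rightarrow> segment) \<Rightarrow> real \<Rightarrow> nat \<Rightarrow> real \<Rightarrow> real" where
  "local_basis m S \<tau> k = seg_nurbs m S \<tau> (seg_of S k) (k - mu S (seg_of S k - 1))"

lemma mu_mono: "i \<le> k \<Longrightarrow> mu S i \<le> mu S k"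
  unfolding mu_def by (rule sum_mono2) auto

lemma local_basis_eq:
  assumes "i \<ge> 1" "j \<in> {1..nspl (S i)}"
  shows "local_basis m S \<tau> (mu S (i-1) + j) = seg_nurbs m S \<tau> i j"
proof -
  have step: "mu S i = mu S (i-1) + nspl (S i)"
    using assms(1) by (cases i) (simp_all add: mu_def)
  have "seg_of S (mu S (i-1) + j) = i"
    unfolding seg_of_def
  proof (rule Least_equality)
    show "mu S (i-1) + j \<le> mu S i" using step assms by simp
  next
    fix y assume y: "mu S (i-1) + j \<le> mu S y"
    show "i \<le> y"
    proof (rule ccontr)
      assume "\<not> i \<le> y"
      then have "mu S y \<le> mu S (i-1)" by (intro mu_mono) simp
      then show False using y assms by simp
    qed
  qed
  then show ?thesis by (simp add: local_basis_def)
qed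

text \<open>
  The subtraction does not truncate for valid segments, since they satisfy \<open>nspl s \<ge> deg s + 1 \<ge> 3\<close>.
\<close>

definition eta :: "(nat \<Rightarrow> segment) \<Rightarrow> nat \<Rightarrow> nat" where
  "eta S i = mu S i - 2 * i"

definition next_seg :: "nat \<Rightarrow> nat \<Rightarrow> nat" where
  "next_seg m i = (if i = m then 1 else i + 1)"

definition alpha :: "(nat \<Rightarrow> segment) \<Rightarrow> nat \<Rightarrow> real" where
  "alpha S i = (let s = S i in
     real (deg s) / (hi s - knot s (nspl s)) * (weight s (nspl s - 1) / weight s (nspl s)))"

definition beta :: "nat \<Rightarrow> (nat \<Rightarrow> segment) \<Rightarrow> nat \<Rightarrow> real" where
  "beta m S i = (let s = S (next_seg m i) in
     real (deg s) / (knot s (deg s + 2) - lo s) * (weight s 2 / weight s 1))"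

text \<open>
  The matrix is the sum of the single-entry matrices for the prescribed non-zero entries. Their
  positions are pairwise distinct for valid segments, so no two contributions are ever added.
\<close>

definition Hc :: "nat \<Rightarrow> (nat \<Rightarrow> segment) \<Rightarrow> nat \<Rightarrow> nat \<Rightarrow> real" where
  "Hc m S r c =
     (\<Sum>i=1..m. \<Sum>j=1..nspl (S i) - 2.
        if r = eta S (i-1) + j \<and> c = mu S (i-1) + j then 1 else 0) +
     (\<Sum>i=1..m-1.
        (if r = eta S i \<and> c \<in> {mu S i - 1, mu S i}
         then alpha S i / (alpha S i + beta m S i) else 0) +
        (if r = eta S i + 1 \<and> c \<in> {mu S i - 1, mu S i}
         then beta m S i / (alpha S i + beta m S i) else 0))"

definition n_full :: "nat \<Rightarrow> (nat \<Rightarrow> segment) \<Rightarrow> nat" where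
  "n_full m S = eta S m + 2"

definition n_per :: "nat \<Rightarrow> (nat \<Rightarrow> segment) \<Rightarrow> nat" where
  "n_per m S = eta S m"

text \<open>Block-diagonal with blocks \<open>1\<close>, \<open>Hc\<close>, \<open>1\<close>, of size \<open>n_full m S \<times> mu S m\<close>.\<close>

definition H_full :: "nat \<Rightarrow> (nat \<Rightarrow> segment) \<Rightarrow> nat \<Rightarrow> nat \<Rightarrow> real" where
  "H_full m S r c =
     (if r = 1 \<and> c = 1 then 1
      else if r = n_full m S \<and> c = mu S m then 1
      else if r \<in> {2..n_full m S - 1} \<and> c \<in> {2..mu S m - 1} then Hc m S (r-1) (c-1)
      else 0)"

definition h_col :: "nat \<Rightarrow> (nat \<Rightarrow> segment) \<Rightarrow> nat \<Rightarrow> real" where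
  "h_col m S r =
     (if r = 1 then beta m S m / (alpha S m + beta m S m) else 0) +
     (if r = n_per m S then alpha S m / (alpha S m + beta m S m) else 0)"

text \<open>The columns \<open>[h | Hc | h]\<close>, of size \<open>n_per m S \<times> mu S m\<close>.\<close>

definition H_per :: "nat \<Rightarrow> (nat \<Rightarrow> segment) \<Rightarrow> nat \<Rightarrow> nat \<Rightarrow> real" where
  "H_per m S r c =
     (if c = 1 \<or> c = mu S m then h_col m S r else Hc m S r (c-1))"

definition B_full :: "nat \<Rightarrow> (nat \<Rightarrow> segment) \<Rightarrow> real \<Rightarrow> nat \<Rightarrow> real \<Rightarrow> real" where
  "B_full m S \<tau> i t = (\<Sum>k=1..mu S m. H_full m S i k * local_basis m S \<tau> k t)"

definition B_per :: "nat \<Rightarrow> (nat \<Rightarrow> segment) \<Rightarrow> real \<Rightarrow> nat \<Rightarrow> real \<Rightarrow> real" where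
  "B_per m S \<tau> i t = (\<Sum>k=1..mu S m. H_per m S i k * local_basis m S \<tau> k t)"

definition lin_indep_on :: "real set \<Rightarrow> nat \<Rightarrow> (nat \<Rightarrow> real \<Rightarrow> real) \<Rightarrow> bool" where
  "lin_indep_on A n F \<longleftrightarrow>
     (\<forall>c::nat \<Rightarrow> real. (\<forall>t\<in>A. (\<Sum>i=1..n. c i * F i t) = 0) \<longrightarrow> (\<forall>i\<in>{1..n}. c i = 0))"

definition convex_partition_of_unity_on :: "real set \<Rightarrow> nat \<Rightarrow> (nat \<Rightarrow> real \<Rightarrow> real) \<Rightarrow> bool" where
  "convex_partition_of_unity_on A n F \<longleftrightarrow>
     (\<forall>i\<in>{1..n}. \<forall>t\<in>A. 0 \<le> F i t) \<and> (\<forall>t\<in>A. (\<Sum>i=1..n. F i t) = 1)"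

text \<open>
  \<open>M\<close> is an \<open>n \<times> N\<close> matrix and \<open>b\<close> a family of \<open>N\<close> functions; the support of \<open>b j\<close> is the set of
  points of \<open>A\<close> where it does not vanish (no closure is taken, which gives the stronger property).
\<close>

definition locally_supported_on ::
  "real set \<Rightarrow> nat \<Rightarrow> nat \<Rightarrow> (nat \<Rightarrow> nat \<Rightarrow> real) \<Rightarrow> (nat \<Rightarrow> real \<Rightarrow> real) \<Rightarrow> (nat \<Rightarrow> real \<Rightarrow> real) \<Rightarrow> bool"
where
  "locally_supported_on A n N M b F \<longleftrightarrow>
     (\<forall>i\<in>{1..n}. \<forall>t\<in>A - (\<Union>j\<in>{j\<in>{1..N}. M i j \<noteq> 0}. support_on A (b j)). F i t = 0)"

end

theory Submission
  imports Defs
begin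

text \<open>
  Everything is reduced to two facts about a linear combination \<open>f\<close> of the local basis with
  coefficients \<open>d\<close>, indexed \<open>1, \<dots>, \<mu>\<^sub>m\<close>.

  The first fact is analytic. On its interval, the NURBS basis of a segment with \<open>n\<close> functions is
  \<open>C\<^sup>1\<close>, non-negative, linearly independent and sums to one; at the left end only the first function
  is non-zero, only the first two have a non-zero derivative, and these derivatives are
  \<open>-\<beta>\<close> and \<open>\<beta>\<close>. At the right end the last two functions behave in the same way with \<open>\<alpha>\<close>. Therefore \<open>f\<close>
  is \<open>C\<^sup>1\<close> on \<open>\<Omega>\<close> as soon as, at every junction between the segments \<open>i\<close> and \<open>i + 1\<close>,
  \<open>d\<close> takes the same value at \<open>\<mu>\<^sub>i\<close> and at \<open>\<mu>\<^sub>i + 1\<close>, and \<open>\<alpha>\<close> times the last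
  coefficient difference on the left is \<open>\<beta>\<close> times the first coefficient difference on the right
  (\<open>combination_in_spline_space\<close>). The same condition between \<open>\<mu>\<^sub>m\<close> and \<open>1\<close> gives periodicity
  (\<open>combination_in_per_spline_space\<close>).

  The second fact is algebraic. Every column of \<open>H\<close> and of \<open>H\<^sup>p\<^sup>e\<^sup>r\<close> is either a unit vector, or a
  convex combination of two unit vectors with weights \<open>\<alpha> / (\<alpha> + \<beta>)\<close> and \<open>\<beta> / (\<alpha> + \<beta>)\<close>; the latter
  happens for the two columns that meet at a junction, which are equal, and in \<open>H\<^sup>p\<^sup>e\<^sup>r\<close> also for
  the first and the last column, where \<open>\<Omega>\<close> is closed up to a circle. With these weights the
  smoothness condition on every row is an identity (\<open>junction_balance\<close>). The columns
  are non-negative with sum one, so non-negativity and the partition of unity pass from the local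
  basis to the combinations; and since every unit vector occurs as a column, the rows are linearly
  independent, so linear independence passes on as well (\<open>spline_family_properties\<close>).

  The B-spline theory behind the first fact is developed from the recursion. The B-splines
  restricted to one knot span are polynomials satisfying the same recursion, started with a
  Kronecker delta. For these polynomials the derivative formula and the partition of unity hold
  on the whole real line, without any case distinction at the knots. The two together give local
  linear independence (\<open>bpiece_lin_indep\<close>), and smoothness amounts to an evaluation of the
  polynomials of two neighbouring spans at their common knot (\<open>bpiece_match\<close>).
\<close>

section \<open>Sums and derivatives\<close>

lemma sum_mult_delta:
  fixes f :: "nat \<Rightarrow> real"
  assumes "k \<in> {1..n}"
  shows "(\<Sum>j=1..n. f j * (if j = k then 1 else 0)) = f k"
  using assms by (simp add: if_distrib[of "(*) _"] cong: if_cong)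

lemma sum_mult_delta_diff:
  fixes f :: "nat \<Rightarrow> real"
  assumes "k \<in> {1..n}" "l \<in> {1..n}"
  shows "(\<Sum>j=1..n. f j * (c * ((if j = k then 1 else 0) - (if j = l then 1 else 0)))) = c * (f k - f l)"
proof -
  have "(\<Sum>j=1..n. f j * (c * ((if j = k then 1 else 0) - (if j = l then 1 else 0)))) =
    (\<Sum>j=1..n. (if j = k then c * f k else 0) - (if j = l then c * f l else 0))"
    by (intro sum.cong refl) auto
  also have "\<dots> = c * (f k - f l)" using assms by (simp add: sum_subtractf right_diff_distrib)
  finally show ?thesis .
qed

lemma sum_atMost_eq:
  fixes f :: "nat \<Rightarrow> real"
  shows "f 0 = 0 \<Longrightarrow> (\<Sum>j\<le>n. f j) = (\<Sum>j=1..n. f j)"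
  by (simp add: atMost_atLeast0 sum.atLeast_Suc_atMost)

lemma sum_shift_vanishing:
  fixes f :: "nat \<Rightarrow> real"
  assumes "f 0 = 0" "f (Suc N) = 0"
  shows "(\<Sum>j\<le>N. g (j+1) * f (j+1)) = (\<Sum>j\<le>N. g j * f j)"
proof -
  have "(\<Sum>j\<le>N. g (j+1) * f (j+1)) = (\<Sum>j\<le>Suc N. g j * f j)"
    using sum.atMost_Suc_shift[of "\<lambda>j. g j * f j" N] assms(1) by simp
  then show ?thesis using assms(2) by simp
qed

lemma DERIV_linear_combination:
  fixes f g :: "real \<Rightarrow> real"
  assumes "(f has_real_derivative f') (at x)" "(g has_real_derivative g') (at x)"
  shows "((\<lambda>x. (x - a) / d * f x + (c - x) / e * g x) has_real_derivative
    (f x / d - g x / e) + ((x - a) / d * f' + (c - x) / e * g')) (at x)"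
proof -
  have "((\<lambda>x. inverse d * ((x - a) * f x) + inverse e * ((c - x) * g x)) has_real_derivative
      inverse d * (1 * f x + f' * (x - a)) + inverse e * ((0 - 1) * g x + g' * (c - x))) (at x)"
    by (intro DERIV_add DERIV_cmult DERIV_mult assms) (auto intro!: derivative_eq_intros)
  then show ?thesis by (simp add: divide_inverse algebra_simps)
qed

text \<open>
  Derivatives can be checked piece by piece: at a point outside a closed piece the filter
  \<open>at x within I l\<close> is trivial, so only the pieces containing \<open>x\<close> matter.
\<close>

lemma has_field_derivative_within_closed_Union:
  assumes "finite L" "\<And>l. l \<in> L \<Longrightarrow> closed (I l)"
    and "\<And>l. l \<in> L \<Longrightarrow> x \<in> I l \<Longrightarrow> (f has_field_derivative D) (at x within I l)"
  shows "(f has_field_derivative D) (at x within (\<Union>l\<in>L. I l))"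
  using assms
proof (induction L rule: finite_induct)
  case empty
  then show ?case by (simp add: has_field_derivative_iff)
next
  case (insert k L)
  have "(f has_field_derivative D) (at x within I k)"
  proof (cases "x \<in> I k")
    case False
    then have "at x within I k = bot"
      using insert.prems(1)[of k] by (simp add: at_within_eq_bot_iff closed_subset)
    then show ?thesis by (simp add: has_field_derivative_iff)
  qed (use insert.prems in auto)
  moreover have "(f has_field_derivative D) (at x within (\<Union>l\<in>L. I l))"
    using insert.prems by (intro insert.IH) auto
  ultimately show ?case
    unfolding has_field_derivative_iff by (simp add: Lim_within_Un)
qed

section \<open>Polynomial pieces of B-splines\<close>

text \<open>
  The polynomial that agrees with the \<open>j\<close>-th B-spline of degree \<open>q\<close> on the knot span
  \<open>[\<xi>\<^sub>l, \<xi>\<^sub>l\<^sub>+\<^sub>1)\<close>: the indicator functions at the bottom of the recursion are constant there.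
\<close>

fun bpiece :: "(nat \<Rightarrow> real) \<Rightarrow> nat \<Rightarrow> nat \<Rightarrow> nat \<Rightarrow> real \<Rightarrow> real" where
  "bpiece \<xi> l 0 j x = (if j = l then 1 else 0)"
| "bpiece \<xi> l (Suc q) j x =
     (x - \<xi> j) / (\<xi> (j + Suc q) - \<xi> j) * bpiece \<xi> l q j x +
     (\<xi> (j + Suc q + 1) - x) / (\<xi> (j + Suc q + 1) - \<xi> (j+1)) * bpiece \<xi> l q (j+1) x"

lemma bspline_rec_eq_bpiece:
  assumes "mono \<xi>" "\<xi> l \<le> x" "x < \<xi> (l+1)"
  shows "bspline_rec \<xi> q j x = bpiece \<xi> l q j x"
proof (induction q arbitrary: j)
  case 0
  have "j = l" if "\<xi> j \<le> x" "x < \<xi> (j+1)" for j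
  proof (rule ccontr)
    assume "j \<noteq> l"
    then consider "j + 1 \<le> l" | "l + 1 \<le> j" by linarith
    then show False
      using monoD[OF \<open>mono \<xi>\<close>, of "j+1" l] monoD[OF \<open>mono \<xi>\<close>, of "l+1" j] assms that
      by cases auto
  qed
  then have "(\<xi> j \<le> x \<and> x < \<xi> (j+1)) = (j = l)" using assms(2,3) by blast
  then show ?case by (simp only: bspline_rec.simps bpiece.simps)
qed simp

lemma bpiece_eq_0: "j > l \<or> j + q < l \<Longrightarrow> bpiece \<xi> l q j x = 0"
  by (induction q arbitrary: j) auto

lemma bpiece_nonneg:
  assumes "mono \<xi>" "\<xi> l \<le> x" "x \<le> \<xi> (l+1)"
  shows "bpiece \<xi> l q j x \<ge> 0"
proof (induction q arbitrary: j)
  case (Suc q)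
  have 1: "(x - \<xi> j) / (\<xi> (j + Suc q) - \<xi> j) * bpiece \<xi> l q j x \<ge> 0"
  proof (cases "j \<le> l")
    case True
    then have "\<xi> j \<le> x" using monoD[OF assms(1), of j l] assms(2) by simp
    moreover have "\<xi> j \<le> \<xi> (j + Suc q)" by (intro monoD[OF assms(1)]) simp
    ultimately show ?thesis using Suc by (intro mult_nonneg_nonneg divide_nonneg_nonneg) auto
  qed (simp add: bpiece_eq_0)
  have 2: "(\<xi> (j + Suc q + 1) - x) / (\<xi> (j + Suc q + 1) - \<xi> (j+1)) * bpiece \<xi> l q (j+1) x \<ge> 0"
  proof (cases "l \<le> j + 1 + q")
    case True
    then have "x \<le> \<xi> (j + Suc q + 1)"
      using monoD[OF assms(1), of "l+1" "j + Suc q + 1"] assms(3) by simp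
    moreover have "\<xi> (j+1) \<le> \<xi> (j + Suc q + 1)" by (intro monoD[OF assms(1)]) simp
    ultimately show ?thesis using Suc by (intro mult_nonneg_nonneg divide_nonneg_nonneg) auto
  qed (simp add: bpiece_eq_0)
  show ?case using 1 2 by simp
qed auto

lemma knots_strict:
  fixes \<xi> :: "nat \<Rightarrow> real"
  assumes "mono \<xi>" "\<xi> l < \<xi> (l+1)" "j \<le> l" "l < k"
  shows "\<xi> j < \<xi> k"
proof -
  have "\<xi> j \<le> \<xi> l" "\<xi> (l+1) \<le> \<xi> k" using assms(3,4) by (intro monoD[OF assms(1)]; simp)+
  then show ?thesis using assms(2) by simp
qed

text \<open>
  Unless it is zero, the polynomial \<open>bpiece \<xi> l q j\<close> enters its two successors of degree
  \<open>q + 1\<close> with coefficients that add up to one.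
\<close>

lemma bpiece_sum:
  assumes "mono \<xi>" "\<xi> l < \<xi> (l+1)" "q \<le> l" "l \<le> N"
  shows "(\<Sum>j\<le>N. bpiece \<xi> l q j x) = 1"
  using assms(3)
proof (induction q)
  case 0
  then show ?case using assms by simp
next
  case (Suc q)
  let ?P = "\<lambda>j. bpiece \<xi> l q j x"
  let ?u = "\<lambda>j. (x - \<xi> j) / (\<xi> (j + Suc q) - \<xi> j)"
  let ?v = "\<lambda>j. (\<xi> (j + Suc q) - x) / (\<xi> (j + Suc q) - \<xi> j)"
  have "(\<Sum>j\<le>N. bpiece \<xi> l (Suc q) j x) = (\<Sum>j\<le>N. ?u j * ?P j) + (\<Sum>j\<le>N. ?v (j+1) * ?P (j+1))"
    by (simp add: sum.distrib)
  also have "(\<Sum>j\<le>N. ?v (j+1) * ?P (j+1)) = (\<Sum>j\<le>N. ?v j * ?P j)"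
    using Suc.prems assms(4) by (intro sum_shift_vanishing) (simp_all add: bpiece_eq_0)
  also have "(\<Sum>j\<le>N. ?u j * ?P j) + (\<Sum>j\<le>N. ?v j * ?P j) = (\<Sum>j\<le>N. ?P j)"
  proof (subst sum.distrib[symmetric], intro sum.cong refl)
    fix j
    show "?u j * ?P j + ?v j * ?P j = ?P j"
    proof (cases "j \<le> l \<and> l \<le> j + q")
      case True
      then have "\<xi> j < \<xi> (j + Suc q)" by (intro knots_strict[OF assms(1,2)]) auto
      then have "?u j + ?v j = 1" by (simp add: add_divide_distrib[symmetric])
      then show ?thesis by (metis distrib_right mult_1)
    qed (auto simp: bpiece_eq_0)
  qed
  finally show ?case using Suc by simp
qed

text \<open>
  Differentiating the recursion and applying the induction hypothesis leaves an identity between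
  combinations of the polynomials of degree \<open>q\<close>. It could fail only in the coefficient of the middle one,
  number \<open>j + 1\<close>, where it amounts to \<open>D / D = 1\<close> for two knot differences
  \<open>D\<close>; if such a \<open>D\<close> is zero, then so is the shorter knot difference by which that polynomial is
  divided, and the convention that such fractions vanish saves the identity.
\<close>

lemma bpiece_deriv:
  assumes "mono \<xi>"
  shows "((\<lambda>x. bpiece \<xi> l (Suc q) j x) has_real_derivative
           real (Suc q) * (bpiece \<xi> l q j x / (\<xi> (j + Suc q) - \<xi> j) -
             bpiece \<xi> l q (j+1) x / (\<xi> (j + Suc q + 1) - \<xi> (j+1)))) (at x)"
proof (induction q arbitrary: j)
  case 0
  show ?case
    by (auto intro!: derivative_eq_intros simp: divide_simps)
next
  case (Suc q)
  define D where "D i k = \<xi> (i + k) - \<xi> i" for i k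
  define P where "P i = bpiece \<xi> l q i x" for i
  let ?Q = "bpiece \<xi> l (Suc q)"
  have rec: "?Q i x = (x - \<xi> i) / D i (Suc q) * P i + (\<xi> (i+q+2) - x) / D (i+1) (Suc q) * P (i+1)" for i
    by (simp add: D_def P_def)
  define Q' where "Q' i = real (Suc q) * (P i / D i (Suc q) - P (i+1) / D (i+1) (Suc q))" for i
  have IH: "(?Q i has_real_derivative Q' i) (at x)" for i
    using Suc[of i] by (simp add: Q'_def D_def P_def del: bpiece.simps)
  have unfold: "bpiece \<xi> l (Suc (Suc q)) j = (\<lambda>x. (x - \<xi> j) / D j (Suc (Suc q)) * ?Q j x +
      (\<xi> (j+q+3) - x) / D (j+1) (Suc (Suc q)) * ?Q (j+1) x)"
    by (rule ext, subst bpiece.simps(2)) (simp add: D_def numeral_3_eq_3)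
  have deriv: "(bpiece \<xi> l (Suc (Suc q)) j has_real_derivative
      (?Q j x / D j (Suc (Suc q)) - ?Q (j+1) x / D (j+1) (Suc (Suc q))) +
      ((x - \<xi> j) / D j (Suc (Suc q)) * Q' j + (\<xi> (j+q+3) - x) / D (j+1) (Suc (Suc q)) * Q' (j+1)))
      (at x)"
    unfolding unfold by (rule DERIV_linear_combination) (rule IH)+
  have zero: "D i (Suc (Suc q)) = 0 \<Longrightarrow> D (i+1) (Suc q) = 0 \<and> D i (Suc q) = 0" for i
    using monoD[OF assms, of i "i+1"] monoD[OF assms, of "i+1" "i+1+Suc q"]
      monoD[OF assms, of i "i+Suc q"] monoD[OF assms, of "i + Suc q" "i+Suc (Suc q)"]
    by (auto simp: D_def)
  have zero': "D i (Suc (Suc q)) = 0 \<Longrightarrow> D (i+1) (Suc q) = 0" for i using zero by blast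
  have zero2: "D (i+1) (Suc (Suc q)) = 0 \<Longrightarrow> D (i+1) (Suc q) = 0" for i using zero[of "i+1"] by blast
  define A B where "A = inverse (D j (Suc (Suc q)))" and "B = inverse (D (j+1) (Suc (Suc q)))"
  define d0 d1 d2 where "d0 = inverse (D j (Suc q))" and "d1 = inverse (D (j+1) (Suc q))" and
    "d2 = inverse (D (j+2) (Suc q))"
  have A: "d1 * (A * (\<xi> (j+q+2) - \<xi> j)) = d1"
    using zero'[of j] by (cases "D j (Suc (Suc q)) = 0") (auto simp: A_def d1_def D_def)
  have B: "d1 * (B * (\<xi> (j+q+3) - \<xi> (j+1))) = d1"
    using zero2[of j] by (cases "D (j+1) (Suc (Suc q)) = 0") (auto simp: B_def d1_def D_def numeral_3_eq_3)
  have key: "(x - \<xi> j) * A * (P j * d0 - P (j+1) * d1) + (\<xi> (j+q+3) - x) * B * (P (j+1) * d1 - P (j+2) * d2)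
     = ((x - \<xi> j) * d0 * P j + (\<xi> (j+q+2) - x) * d1 * P (j+1)) * A -
       ((x - \<xi> (j+1)) * d1 * P (j+1) + (\<xi> (j+q+3) - x) * d2 * P (j+2)) * B" (is "?L = ?R")
  proof -
    have "?L - ?R = P (j+1) * (d1 * (B * (\<xi> (j+q+3) - \<xi> (j+1))) - d1 * (A * (\<xi> (j+q+2) - \<xi> j)))"
      by (simp add: algebra_simps)
    then show ?thesis unfolding A B by simp
  qed
  have Q': "Q' j = real (Suc q) * (P j * d0 - P (j+1) * d1)"
      "Q' (j+1) = real (Suc q) * (P (j+1) * d1 - P (j+2) * d2)"
    by (simp_all add: Q'_def d0_def d1_def d2_def divide_inverse)
  have Q: "?Q j x = (x - \<xi> j) * d0 * P j + (\<xi> (j+q+2) - x) * d1 * P (j+1)"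
      "?Q (j+1) x = (x - \<xi> (j+1)) * d1 * P (j+1) + (\<xi> (j+q+3) - x) * d2 * P (j+2)"
    unfolding rec by (simp_all add: d0_def d1_def d2_def divide_inverse numeral_3_eq_3)
  have "(?Q j x * A - ?Q (j+1) x * B) + ((x - \<xi> j) * A * Q' j + (\<xi> (j+q+3) - x) * B * Q' (j+1)) =
    (?Q j x * A - ?Q (j+1) x * B) + real (Suc q) * (?Q j x * A - ?Q (j+1) x * B)"
    unfolding Q' Q key[symmetric] by (simp only: ring_distribs mult_ac)
  also have "\<dots> = real (Suc (Suc q)) * (?Q j x * A - ?Q (j+1) x * B)"
    unfolding of_nat_Suc[of "Suc q"] distrib_right mult_1 ..
  finally have "(bpiece \<xi> l (Suc (Suc q)) j has_real_derivative
      real (Suc (Suc q)) * (?Q j x * A - ?Q (j+1) x * B)) (at x)"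
    using deriv unfolding divide_inverse A_def[symmetric] B_def[symmetric] by (simp only:)
  then show ?case
    by (simp only: A_def B_def D_def divide_inverse) (simp add: add_ac del: bpiece.simps)
qed

text \<open>
  If a combination vanishes on the span, then so does its derivative, which is a combination of
  polynomials of lower degree whose coefficients are multiples of the differences
  \<open>c\<^sub>j - c\<^sub>j\<^sub>-\<^sub>1\<close>. By induction all the coefficients are equal, and by the partition of unity their
  common value is the value of the combination, zero.
\<close>

lemma bpiece_lin_indep:
  assumes "mono \<xi>" "\<xi> l < \<xi> (l+1)" "q \<le> l" "l \<le> N"
    and "\<And>x. x \<in> {\<xi> l<..<\<xi> (l+1)} \<Longrightarrow> (\<Sum>j\<le>N. c j * bpiece \<xi> l q j x) = 0"
    and "j \<le> l" "l \<le> j + q"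
  shows "c j = 0"
  using assms(3,5-7)
proof (induction q arbitrary: c j)
  case 0
  obtain x where "x \<in> {\<xi> l<..<\<xi> (l+1)}" using dense[OF assms(2)] by auto
  then have "(\<Sum>j\<le>N. c j * bpiece \<xi> l 0 j x) = 0" by (rule 0)
  moreover have "(\<Sum>i\<le>N. c i * bpiece \<xi> l 0 i x) = (\<Sum>i\<in>{l}. c i)"
    using assms(4) by (intro sum.mono_neutral_cong_right) auto
  ultimately show ?case using 0 by simp
next
  case (Suc q)
  let ?I = "{\<xi> l<..<\<xi> (l+1)}"
  let ?w = "\<lambda>i. inverse (\<xi> (i + Suc q) - \<xi> i)"
  let ?d = "\<lambda>i. (c i - c (i-1)) * ?w i"
  have "(\<Sum>i\<le>N. ?d i * bpiece \<xi> l q i x) = 0" if x: "x \<in> ?I" for x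
  proof -
    let ?P = "\<lambda>i. bpiece \<xi> l q i x"
    let ?D = "\<Sum>i\<le>N. c i * (real (Suc q) * (?P i / (\<xi> (i + Suc q) - \<xi> i) - ?P (i+1) / (\<xi> (i + Suc q + 1) - \<xi> (i+1))))"
    have D: "((\<lambda>x. \<Sum>i\<le>N. c i * bpiece \<xi> l (Suc q) i x) has_real_derivative ?D) (at x)"
      by (intro DERIV_sum DERIV_cmult bpiece_deriv assms)
    have "((\<lambda>x. 0) has_real_derivative ?D) (at x)"
      by (rule has_field_derivative_transform_within_open[OF D _ x]) (use Suc.prems in auto)
    then have "?D = 0" by (rule DERIV_unique) simp
    moreover have "?D = real (Suc q) * ((\<Sum>i\<le>N. c i * ?w i * ?P i) - (\<Sum>i\<le>N. c (i+1-1) * ?w (i+1) * ?P (i+1)))"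
      unfolding sum_subtractf[symmetric] sum_distrib_left
      by (intro sum.cong) (simp_all add: divide_inverse algebra_simps)
    moreover have "(\<Sum>i\<le>N. c (i+1-1) * ?w (i+1) * ?P (i+1)) = (\<Sum>i\<le>N. c (i-1) * ?w i * ?P i)"
      using Suc.prems assms(4)
      by (intro sum_shift_vanishing[where g = "\<lambda>i. c (i-1) * ?w i"]) (simp_all add: bpiece_eq_0)
    ultimately have "(\<Sum>i\<le>N. c i * ?w i * ?P i) - (\<Sum>i\<le>N. c (i-1) * ?w i * ?P i) = 0" by simp
    then show ?thesis unfolding sum_subtractf[symmetric] by (simp add: algebra_simps)
  qed
  then have d0: "?d i = 0" if "i \<le> l" "l \<le> i + q" for i
    using Suc.IH[of ?d i] Suc.prems(1) that by simp
  have step: "c i = c (i-1)" if "i \<le> l" "l \<le> i + q" for i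
  proof -
    have "\<xi> i < \<xi> (i + Suc q)" using that by (intro knots_strict[OF assms(1,2)]) auto
    then show ?thesis using d0[OF that] by simp
  qed
  have const: "c i = c l" if "i \<le> l" "l \<le> i + Suc q" for i
    using that
  proof (induction "l - i" arbitrary: i)
    case 0
    then show ?case by simp
  next
    case (Suc k)
    then have "c (Suc i) = c l" by (intro Suc.hyps) auto
    moreover have "c (Suc i) = c i" using step[of "Suc i"] Suc by simp
    ultimately show ?case by simp
  qed
  obtain x where x: "x \<in> ?I" using dense[OF assms(2)] by auto
  have "0 = (\<Sum>i\<le>N. c i * bpiece \<xi> l (Suc q) i x)" by (rule Suc.prems(2)[OF x, symmetric])
  also have "\<dots> = (\<Sum>i\<le>N. c l * bpiece \<xi> l (Suc q) i x)"
  proof (intro sum.cong refl)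
    fix i
    show "c i * bpiece \<xi> l (Suc q) i x = c l * bpiece \<xi> l (Suc q) i x"
    proof (cases "i \<le> l \<and> l \<le> i + Suc q")
      case True
      then have "c i = c l" by (intro const) auto
      then show ?thesis by (rule arg_cong)
    next
      case False
      then have "bpiece \<xi> l (Suc q) i x = 0" by (intro bpiece_eq_0) auto
      then show ?thesis by (simp only: mult_zero_right)
    qed
  qed
  also have "\<dots> = c l"
    unfolding sum_distrib_left[symmetric] using bpiece_sum[OF assms(1,2) Suc.prems(1) assms(4)] by simp
  finally have "c l = 0" by (rule sym)
  then show ?case using const[OF Suc.prems(3,4)] by (simp only:)
qed

text \<open>
  Of the polynomials of degree \<open>q\<close> on a span next to \<open>q\<close> coinciding knots, only one is non-zero at these knots,
  because its two coefficients in each step of the recursion have the values one and zero there. Here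
  the knots are at the right end of the span, in the next lemma at its left end.
\<close>

lemma bpiece_at_right_end:
  assumes "\<xi> l < x" "\<And>i. i \<in> {l+1..l+q} \<Longrightarrow> \<xi> i = x"
  shows "bpiece \<xi> l q j x = (if j = l then 1 else 0)"
  using assms(2)
proof (induction q arbitrary: j)
  case (Suc q)
  have IH: "bpiece \<xi> l q j x = (if j = l then 1 else 0)" for j
    by (rule Suc.IH, rule Suc.prems) auto
  have "\<xi> (l + Suc q) = x" using Suc.prems by simp
  then show ?case unfolding bpiece.simps(2) IH using assms(1) by auto
qed simp

lemma bpiece_at_left_end:
  assumes "x < \<xi> (k+q+1)" "\<And>i. i \<in> {k+1..k+q} \<Longrightarrow> \<xi> i = x"
  shows "bpiece \<xi> (k+q) q j x = (if j = k then 1 else 0)"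
  using assms
proof (induction q arbitrary: j k)
  case (Suc q)
  have IH: "bpiece \<xi> (k + Suc q) q j x = (if j = k+1 then 1 else 0)" for j
  proof -
    have "bpiece \<xi> (k + 1 + q) q j x = (if j = k+1 then 1 else 0)"
    proof (rule Suc.IH)
      show "x < \<xi> (k + 1 + q + 1)" using Suc.prems(1) by simp
    qed (rule Suc.prems(2), simp)
    then show ?thesis by simp
  qed
  have "\<xi> (k + 1) = x" using Suc.prems by simp
  then show ?case unfolding bpiece.simps(2) IH using Suc.prems(1) by auto
qed simp

text \<open>
  Here \<open>x\<close> is a knot of multiplicity \<open>r - l\<close> between the spans \<open>l\<close> and \<open>r\<close>, so the claim is that
  splines of degree \<open>q\<close> are continuous at knots of multiplicity up to \<open>q\<close>. Lower multiplicities are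
  inherited through the recursion; for multiplicity exactly \<open>q\<close>, both sides are the same Kronecker delta.
\<close>

lemma bpiece_match:
  assumes "\<xi> l < x" "x < \<xi> (r+1)" "\<And>i. i \<in> {l+1..r} \<Longrightarrow> \<xi> i = x" "l < r" "r \<le> l + q"
  shows "bpiece \<xi> l q j x = bpiece \<xi> r q j x"
  using assms(5)
proof (induction q arbitrary: j)
  case 0
  then show ?case using assms(4) by simp
next
  case (Suc q)
  show ?case
  proof (cases "r \<le> l + q")
    case True
    then show ?thesis using Suc.IH by simp
  next
    case False
    with Suc.prems have r: "r = l + Suc q" by simp
    have "bpiece \<xi> l (Suc q) j x = (if j = l then 1 else 0)"
      using assms(3) r by (intro bpiece_at_right_end assms) auto
    moreover have "bpiece \<xi> (l + Suc q) (Suc q) j x = (if j = l then 1 else 0)"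
      using assms(2,3) r by (intro bpiece_at_left_end assms) auto
    ultimately show ?thesis unfolding r by simp
  qed
qed

lemma bpiece_continuous: "continuous_on A (bpiece \<xi> l q j)"
  by (induction q arbitrary: j) (auto simp: divide_inverse intro!: continuous_intros)

section \<open>B-splines on clamped knots\<close>

text \<open>
  The knots are an infinite non-decreasing sequence here, constant outside the index range of an
  open knot vector, which removes the index bounds from all statements. The bound on inner multiplicities takes
  the form that \<open>p\<close> consecutive knots cannot agree inside \<open>(a, b)\<close>.
\<close>

locale clamped_knots =
  fixes \<xi> :: "nat \<Rightarrow> real" and p n :: nat and a b :: real
  assumes knots_mono: "mono \<xi>" and deg_ge_2: "2 \<le> p" and deg_less: "p < n"
    and knots_left: "\<And>i. i \<le> p + 1 \<Longrightarrow> \<xi> i = a" and left_multiplicity: "a < \<xi> (p + 2)"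
    and knots_right: "\<And>i. n < i \<Longrightarrow> \<xi> i = b" and right_multiplicity: "\<xi> n < b"
    and inner_multiplicity: "\<And>i. a < \<xi> i \<Longrightarrow> \<xi> i < b \<Longrightarrow> \<xi> i < \<xi> (i + (p - 1))"
begin

text \<open>
  The indices of the non-degenerate knot spans. The left end \<open>a\<close> is the knot number \<open>p + 1\<close>, the
  right end \<open>b\<close> the knot number \<open>n + 1\<close>.
\<close>

definition spans :: "nat set" where
  "spans = {l \<in> {p+1..n}. \<xi> l < \<xi> (l+1)}"

lemma finite_spans: "finite spans"
  by (simp add: spans_def)

lemma knot_le: "i \<le> k \<Longrightarrow> \<xi> i \<le> \<xi> k"
  using knots_mono by (rule monoD)

lemma knot_ge_a: "a \<le> \<xi> i"
  using knot_le[of 0 i] knots_left[of 0] by simp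

lemma knot_le_b: "\<xi> i \<le> b"
  using knot_le[of i "i + n + 1"] knots_right[of "i + n + 1"] by simp

lemma span_of_point:
  assumes "a \<le> x" "x < b"
  obtains l where "l \<in> spans" "\<xi> l \<le> x" "x < \<xi> (l+1)"
proof -
  define M where "M = {l. l \<le> n \<and> \<xi> l \<le> x}"
  define l where "l = Max M"
  have fin: "finite M" by (rule finite_subset[of _ "{..n}"]) (auto simp: M_def)
  have p1: "p + 1 \<in> M" using knots_left[of "p+1"] assms deg_less by (simp add: M_def)
  then have "l \<in> M" unfolding l_def using fin by (intro Max_in) auto
  have "p + 1 \<le> l" unfolding l_def using fin p1 by (rule Max_ge)
  have "x < \<xi> (l+1)"
  proof (rule ccontr)
    assume "\<not> x < \<xi> (l+1)"
    then have "l + 1 \<in> M"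
      using \<open>l \<in> M\<close> knots_right[of "l+1"] assms(2) by (cases "l = n") (auto simp: M_def)
    then have "l + 1 \<le> l" unfolding l_def using fin by (intro Max_ge)
    then show False by simp
  qed
  with \<open>l \<in> M\<close> \<open>p + 1 \<le> l\<close> show ?thesis
    by (intro that[of l]) (auto simp: M_def spans_def)
qed

lemma n_in_spans: "n \<in> spans"
  using right_multiplicity knots_right[of "n+1"] deg_less by (simp add: spans_def)

lemma spans_cover: "(\<Union>l\<in>spans. {\<xi> l..\<xi> (l+1)}) = {a..b}"
proof (intro equalityI subsetI)
  fix x assume x: "x \<in> {a..b}"
  show "x \<in> (\<Union>l\<in>spans. {\<xi> l..\<xi> (l+1)})"
  proof (cases "x = b")
    case True
    then show ?thesis
      using n_in_spans right_multiplicity knots_right[of "n+1"] by (intro UN_I[of n]) auto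
  next
    case False
    with x obtain l where "l \<in> spans" "\<xi> l \<le> x" "x < \<xi> (l+1)" using span_of_point[of x] by auto
    then show ?thesis by (intro UN_I[of l]) auto
  qed
next
  fix x assume "x \<in> (\<Union>l\<in>spans. {\<xi> l..\<xi> (l+1)})"
  then obtain l where "\<xi> l \<le> x" "x \<le> \<xi> (l+1)" by auto
  then show "x \<in> {a..b}" using knot_ge_a[of l] knot_le_b[of "l+1"] by simp
qed

text \<open>
  The closed span is the point of this lemma. At its right end the B-spline is given by
  the polynomial of the next span, or by the limit convention at \<open>b\<close>. Degree \<open>p - 1\<close> is
  included for the derivatives; it is the lowest degree for which inner knots, of multiplicity up to
  \<open>p - 1\<close>, guarantee continuity.
\<close>

lemma bspline_eq_bpiece:
  assumes l: "l \<in> spans" and x: "\<xi> l \<le> x" "x \<le> \<xi> (l+1)" and q: "p \<le> q + 1"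
  shows "bspline \<xi> b q j x = bpiece \<xi> l q j x"
proof -
  have le: "\<xi> l < \<xi> (l+1)" and l': "p + 1 \<le> l" "l \<le> n" using l by (auto simp: spans_def)
  consider "x < \<xi> (l+1)" | "x = \<xi> (l+1)" "x = b" | "x = \<xi> (l+1)" "x < b"
    using x knot_le_b[of "l+1"] by linarith
  then show ?thesis
  proof cases
    case 1
    then have "x \<noteq> b" using knot_le_b[of "l+1"] by simp
    then show ?thesis
      unfolding bspline_def using bspline_rec_eq_bpiece[OF knots_mono x(1) 1] by simp
  next
    case 2
    have "(bpiece \<xi> l q j \<longlongrightarrow> bpiece \<xi> l q j b) (at_left b)"
      using bpiece_continuous[of UNIV \<xi> l q j]
      by (intro isCont_tendsto_compose[of b "bpiece \<xi> l q j" "\<lambda>x. x" "at_left b"] tendsto_ident_at)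
         (auto simp: continuous_on_eq_continuous_at)
    moreover have "\<forall>\<^sub>F y in at_left b. bpiece \<xi> l q j y = bspline_rec \<xi> q j y"
      using eventually_at_left_real[of "\<xi> l" b]
    proof (rule eventually_mono)
      show "\<xi> l < b" using le 2 by simp
      fix y assume "y \<in> {\<xi> l<..<b}"
      then show "bpiece \<xi> l q j y = bspline_rec \<xi> q j y"
        using bspline_rec_eq_bpiece[OF knots_mono, of l y q j] 2 by simp
    qed
    ultimately have "(bspline_rec \<xi> q j \<longlongrightarrow> bpiece \<xi> l q j b) (at_left b)"
      by (rule Lim_transform_eventually)
    then have "Lim (at_left b) (bspline_rec \<xi> q j) = bpiece \<xi> l q j b"
      by (intro tendsto_Lim) simp_all
    then show ?thesis using 2(2) by (simp add: bspline_def)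
  next
    case 3
    have ax: "a < x" using knot_ge_a[of l] le 3 by simp
    then obtain r where r: "r \<in> spans" "\<xi> r \<le> x" "x < \<xi> (r+1)"
      using span_of_point[of x] 3 by auto
    have "l < r"
    proof (rule ccontr)
      assume "\<not> l < r"
      then show False using knot_le[of "r+1" "l+1"] r 3 by simp
    qed
    have eq: "\<xi> i = x" if "i \<in> {l+1..r}" for i
      using knot_le[of "l+1" i] knot_le[of i r] that 3 r(2) by simp
    have "r \<le> l + q"
    proof (rule ccontr)
      assume "\<not> r \<le> l + q"
      then have "\<xi> (l + 1 + (p - 1)) = x" "\<xi> (l + 1) = x" using q deg_ge_2 by (auto intro!: eq)
      then show False using inner_multiplicity[of "l+1"] ax 3(2) by simp
    qed
    have "bspline \<xi> b q j x = bpiece \<xi> r q j x"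
      unfolding bspline_def using bspline_rec_eq_bpiece[OF knots_mono r(2,3)] 3 by simp
    also have "\<dots> = bpiece \<xi> l q j x"
      using le 3 by (intro bpiece_match[symmetric] knots_mono r eq \<open>l < r\<close> \<open>r \<le> l + q\<close>) auto
    finally show ?thesis .
  qed
qed

lemma span_cases:
  assumes "x \<in> {a..b}"
  obtains l where "l \<in> spans" "\<xi> l \<le> x" "x \<le> \<xi> (l+1)" "p + 1 \<le> l" "l \<le> n" "\<xi> l < \<xi> (l+1)"
proof -
  obtain l where "l \<in> spans" "x \<in> {\<xi> l..\<xi> (l+1)}" using assms spans_cover by blast
  then show ?thesis using that by (auto simp: spans_def)
qed

lemma bspline_continuous:
  assumes "p \<le> q + 1"
  shows "continuous_on {a..b} (bspline \<xi> b q j)"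
proof -
  have "continuous_on {\<xi> l..\<xi> (l+1)} (bspline \<xi> b q j)" if "l \<in> spans" for l
  proof (rule continuous_on_eq[OF bpiece_continuous[of _ \<xi> l q j]])
    fix x assume "x \<in> {\<xi> l..\<xi> (l+1)}"
    then show "bpiece \<xi> l q j x = bspline \<xi> b q j x" using that assms by (simp add: bspline_eq_bpiece)
  qed
  then have "continuous_on (\<Union>l\<in>spans. {\<xi> l..\<xi> (l+1)}) (bspline \<xi> b q j)"
    by (intro continuous_on_closed_Union finite_spans) auto
  then show ?thesis by (simp only: spans_cover)
qed

definition bspline_deriv :: "nat \<Rightarrow> real \<Rightarrow> real" where
  "bspline_deriv j x = real p * (bspline \<xi> b (p-1) j x / (\<xi> (j+p) - \<xi> j) -
     bspline \<xi> b (p-1) (j+1) x / (\<xi> (j+p+1) - \<xi> (j+1)))"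

lemma bspline_deriv_continuous: "continuous_on {a..b} (bspline_deriv j)"
  unfolding bspline_deriv_def divide_inverse
  by (intro continuous_intros bspline_continuous) simp_all

lemma bspline_has_derivative:
  "(bspline \<xi> b p j has_real_derivative bspline_deriv j x) (at x within {a..b})"
proof -
  have "(bspline \<xi> b p j has_real_derivative bspline_deriv j x) (at x within (\<Union>l\<in>spans. {\<xi> l..\<xi> (l+1)}))"
  proof (rule has_field_derivative_within_closed_Union[OF finite_spans])
    fix l assume l: "l \<in> spans" "x \<in> {\<xi> l..\<xi> (l+1)}"
    obtain q where q: "p = Suc q" using deg_ge_2 by (cases p) auto
    have "(bpiece \<xi> l p j has_real_derivative
        real p * (bpiece \<xi> l (p-1) j x / (\<xi> (j+p) - \<xi> j) - bpiece \<xi> l (p-1) (j+1) x / (\<xi> (j+p+1) - \<xi> (j+1))))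
        (at x within {\<xi> l..\<xi> (l+1)})"
      using has_field_derivative_at_within[OF bpiece_deriv[OF knots_mono, of l q j x]]
      by (simp add: q del: bpiece.simps)
    also have "real p * (bpiece \<xi> l (p-1) j x / (\<xi> (j+p) - \<xi> j) - bpiece \<xi> l (p-1) (j+1) x / (\<xi> (j+p+1) - \<xi> (j+1)))
        = bspline_deriv j x"
      using l by (simp add: bspline_deriv_def bspline_eq_bpiece)
    finally show "(bspline \<xi> b p j has_real_derivative bspline_deriv j x) (at x within {\<xi> l..\<xi> (l+1)})"
      by (rule has_field_derivative_transform_within[of _ _ _ _ 1])
         (use l in \<open>auto simp: bspline_eq_bpiece\<close>)
  qed simp
  then show ?thesis by (simp only: spans_cover)
qed

lemma bspline_nonneg:
  assumes "x \<in> {a..b}"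
  shows "bspline \<xi> b p j x \<ge> 0"
proof -
  from assms obtain l where l: "l \<in> spans" "\<xi> l \<le> x" "x \<le> \<xi> (l+1)" by (rule span_cases)
  then show ?thesis by (simp add: bspline_eq_bpiece bpiece_nonneg knots_mono)
qed

lemma bspline_sum:
  assumes "x \<in> {a..b}"
  shows "(\<Sum>j=1..n. bspline \<xi> b p j x) = 1"
proof -
  from assms obtain l where l: "l \<in> spans" "\<xi> l \<le> x" "x \<le> \<xi> (l+1)" "p + 1 \<le> l" "l \<le> n" "\<xi> l < \<xi> (l+1)"
    by (rule span_cases)
  have "(\<Sum>j=1..n. bspline \<xi> b p j x) = (\<Sum>j=1..n. bpiece \<xi> l p j x)"
    using l by (simp add: bspline_eq_bpiece)
  also have "\<dots> = (\<Sum>j\<le>n. bpiece \<xi> l p j x)"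
    using l by (intro sum_atMost_eq[symmetric] bpiece_eq_0) simp
  also have "\<dots> = 1" using l knots_mono by (intro bpiece_sum) auto
  finally show ?thesis .
qed

text \<open>
  The support of every B-spline contains a non-degenerate span, because no knot has multiplicity
  above \<open>p + 1\<close>; local linear independence on that span isolates the coefficient.
\<close>

lemma bspline_lin_indep:
  assumes zero: "\<And>x. x \<in> {a..<b} \<Longrightarrow> (\<Sum>j=1..n. c j * bspline \<xi> b p j x) = 0"
    and j: "j \<in> {1..n}"
  shows "c j = 0"
proof -
  have "\<xi> j < b" using knot_le[of j n] right_multiplicity j by simp
  then obtain l where l: "l \<in> spans" "\<xi> l \<le> \<xi> j" "\<xi> j < \<xi> (l+1)"
    using span_of_point[of "\<xi> j"] knot_ge_a[of j] by auto
  have l': "p + 1 \<le> l" "l \<le> n" "\<xi> l < \<xi> (l+1)" using l by (auto simp: spans_def)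
  have "\<xi> j < \<xi> (j + p + 1)"
  proof (cases "\<xi> j = a")
    case True
    then show ?thesis using left_multiplicity knot_le[of "p+2" "j+p+1"] j by simp
  next
    case False
    then have "\<xi> j < \<xi> (j + (p - 1))"
      using inner_multiplicity[of j] knot_ge_a[of j] \<open>\<xi> j < b\<close> by simp
    also have "\<dots> \<le> \<xi> (j + p + 1)" by (rule knot_le) simp
    finally show ?thesis .
  qed
  have "j \<le> l"
  proof (rule ccontr)
    assume "\<not> j \<le> l"
    then show False using knot_le[of "l+1" j] l by simp
  qed
  have "l \<le> j + p"
  proof (rule ccontr)
    assume "\<not> l \<le> j + p"
    then show False using knot_le[of "j+p+1" l] l \<open>\<xi> j < \<xi> (j + p + 1)\<close> by simp
  qed
  have "(\<Sum>i\<le>n. c i * bpiece \<xi> l p i x) = 0" if "x \<in> {\<xi> l<..<\<xi> (l+1)}" for x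
  proof -
    have x: "x \<in> {a..<b}" using that knot_ge_a[of l] knot_le_b[of "l+1"] by simp
    have "(\<Sum>i\<le>n. c i * bpiece \<xi> l p i x) = (\<Sum>i=1..n. c i * bpiece \<xi> l p i x)"
      using l' by (intro sum_atMost_eq) (simp add: bpiece_eq_0)
    also have "\<dots> = (\<Sum>i=1..n. c i * bspline \<xi> b p i x)"
      using l that by (simp add: bspline_eq_bpiece)
    finally show ?thesis using zero[OF x] by simp
  qed
  then show ?thesis
    using l' \<open>j \<le> l\<close> \<open>l \<le> j + p\<close> by (intro bpiece_lin_indep[OF knots_mono, of l p n c j]) auto
qed

lemma bspline_at_a:
  shows "bspline \<xi> b p j a = (if j = 1 then 1 else 0)"
    and "bspline \<xi> b (p-1) j a = (if j = 2 then 1 else 0)"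
proof -
  have l: "p + 1 \<in> spans" using deg_less left_multiplicity knots_left[of "p+1"] by (simp add: spans_def)
  have "bspline \<xi> b q j a = bpiece \<xi> (p+1) q j a" if "p \<le> q + 1" for q
    using l left_multiplicity knots_left[of "p+1"] that by (intro bspline_eq_bpiece) auto
  moreover have "bpiece \<xi> (1 + p) p j a = (if j = 1 then 1 else 0)"
    using left_multiplicity by (intro bpiece_at_left_end knots_mono) (auto intro: knots_left)
  moreover have "bpiece \<xi> (2 + (p-1)) (p-1) j a = (if j = 2 then 1 else 0)"
    using left_multiplicity deg_ge_2 by (intro bpiece_at_left_end knots_mono) (auto intro: knots_left)
  moreover have "2 + (p-1) = p + 1" using deg_ge_2 by simp
  ultimately show "bspline \<xi> b p j a = (if j = 1 then 1 else 0)"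
    "bspline \<xi> b (p-1) j a = (if j = 2 then 1 else 0)" by (simp_all add: add.commute)
qed

lemma bspline_at_b:
  assumes "p \<le> q + 1"
  shows "bspline \<xi> b q j b = (if j = n then 1 else 0)"
proof -
  have "bspline \<xi> b q j b = bpiece \<xi> n q j b"
    using n_in_spans right_multiplicity knots_right[of "n+1"] assms by (intro bspline_eq_bpiece) auto
  also have "\<dots> = (if j = n then 1 else 0)"
    using right_multiplicity by (intro bpiece_at_right_end knots_mono) (auto intro: knots_right)
  finally show ?thesis .
qed

lemma bspline_deriv_at_a:
  "bspline_deriv j a = real p / (\<xi> (p+2) - a) * ((if j = 2 then 1 else 0) - (if j = 1 then 1 else 0))"
  unfolding bspline_deriv_def bspline_at_a using knots_left[of 2] deg_ge_2 by (auto simp: numeral_2_eq_2)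

lemma bspline_deriv_at_b:
  "bspline_deriv j b = real p / (b - \<xi> n) * ((if j = n then 1 else 0) - (if j + 1 = n then 1 else 0))"
  using knots_right[of "n+p"] deg_ge_2 by (auto simp: bspline_deriv_def bspline_at_b)

end

section \<open>NURBS on one segment\<close>

lemma bspline_rec_cong:
  assumes "\<And>i. i \<in> {j..j+q+1} \<Longrightarrow> \<xi> i = \<xi>' i"
  shows "bspline_rec \<xi> q j = bspline_rec \<xi>' q j"
  using assms
proof (induction q arbitrary: j)
  case (Suc q)
  have "bspline_rec \<xi> q j = bspline_rec \<xi>' q j" "bspline_rec \<xi> q (j+1) = bspline_rec \<xi>' q (j+1)"
    by (rule Suc.IH, rule Suc.prems, simp)+
  moreover have "\<xi> j = \<xi>' j" "\<xi> (j+1) = \<xi>' (j+1)" "\<xi> (j + Suc q) = \<xi>' (j + Suc q)"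
      "\<xi> (j + Suc q + 1) = \<xi>' (j + Suc q + 1)"
    by (rule Suc.prems, simp)+
  ultimately show ?case by (intro ext) (simp only: bspline_rec.simps)
qed auto

text \<open>
  Clamping the index at both ends repeats the first and the last knot, which keeps the sequence
  non-decreasing and changes none of the B-splines \<open>1, \<dots>, nspl s\<close>.
\<close>

definition extended_knot :: "segment \<Rightarrow> nat \<Rightarrow> real" where
  "extended_knot s i = knot s (max 1 (min i (nspl s + deg s + 1)))"

locale nurbs_segment =
  fixes s :: segment
  assumes valid: "valid_segment s"
begin

lemma
  shows extended_knot_mono: "mono (extended_knot s)"
    and deg_less_nspl: "deg s < nspl s"
    and extended_knot_eq: "i \<in> {1..nspl s + deg s + 1} \<Longrightarrow> extended_knot s i = knot s i"
proof -
  have okv: "open_knot_vector (deg s) (nspl s) (knot s) (lo s) (hi s)" and lohi: "lo s < hi s"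
    using valid by (auto simp: valid_segment_def)
  show "mono (extended_knot s)"
  proof (rule incseq_SucI)
    fix i
    consider "i = 0" | "i \<in> {1..nspl s + deg s}" | "i > nspl s + deg s" by force
    then show "extended_knot s i \<le> extended_knot s (Suc i)"
    proof cases
      case 2
      then show ?thesis using okv by (simp add: extended_knot_def open_knot_vector_def)
    qed (simp_all add: extended_knot_def)
  qed
  show "deg s < nspl s"
  proof (rule ccontr)
    assume "\<not> deg s < nspl s"
    then have "nspl s + 1 \<in> {1..deg s + 1}" "nspl s + 1 \<in> {nspl s + 1..nspl s + deg s + 1}" by auto
    then have "knot s (nspl s + 1) = lo s" "knot s (nspl s + 1) = hi s"
      using okv unfolding open_knot_vector_def by blast+
    then show False using lohi by simp
  qed
  show "i \<in> {1..nspl s + deg s + 1} \<Longrightarrow> extended_knot s i = knot s i"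
    by (simp add: extended_knot_def)
qed

sublocale clamped_knots "extended_knot s" "deg s" "nspl s" "lo s" "hi s"
proof
  have okv: "open_knot_vector (deg s) (nspl s) (knot s) (lo s) (hi s)" and lohi: "lo s < hi s"
    and p2: "2 \<le> deg s"
    using valid by (auto simp: valid_segment_def)
  show "mono (extended_knot s)" "deg s < nspl s" "2 \<le> deg s"
    using extended_knot_mono deg_less_nspl p2 by auto
  show left: "extended_knot s i = lo s" if "i \<le> deg s + 1" for i
    using okv that by (auto simp: extended_knot_def open_knot_vector_def max_def min_def)
  show right: "extended_knot s i = hi s" if "nspl s < i" for i
    using okv that by (auto simp: extended_knot_def open_knot_vector_def max_def min_def)
  show "lo s < extended_knot s (deg s + 2)" "extended_knot s (nspl s) < hi s"
    using okv deg_less_nspl by (simp_all add: extended_knot_eq open_knot_vector_def)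
  show "extended_knot s i < extended_knot s (i + (deg s - 1))"
    if i: "lo s < extended_knot s i" "extended_knot s i < hi s" for i
  proof (rule ccontr)
    assume *: "\<not> extended_knot s i < extended_knot s (i + (deg s - 1))"
    have "1 \<le> i" using i left[of i] by (cases "i \<le> deg s + 1") auto
    have "i \<le> nspl s" using i right[of i] by (cases "nspl s < i") auto
    let ?K = "{j \<in> {1..nspl s + deg s + 1}. knot s j = knot s i}"
    have "{i..i + (deg s - 1)} \<subseteq> ?K"
    proof
      fix j assume j: "j \<in> {i..i + (deg s - 1)}"
      then have "extended_knot s j = extended_knot s i"
        using * monoD[OF extended_knot_mono, of i j] monoD[OF extended_knot_mono, of j "i + (deg s - 1)"]
        by simp
      moreover have "j \<in> {1..nspl s + deg s + 1}" "i \<in> {1..nspl s + deg s + 1}"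
        using j \<open>1 \<le> i\<close> \<open>i \<le> nspl s\<close> p2 by auto
      ultimately show "j \<in> ?K" by (simp add: extended_knot_eq)
    qed
    then have "card {i..i + (deg s - 1)} \<le> card ?K" by (intro card_mono) auto
    moreover have "card ?K \<in> {1..deg s - 1}"
      using okv i \<open>1 \<le> i\<close> \<open>i \<le> nspl s\<close> by (simp add: open_knot_vector_def extended_knot_eq)
    ultimately show False by simp
  qed
qed

abbreviation bs :: "nat \<Rightarrow> real \<Rightarrow> real" where
  "bs \<equiv> bspline (extended_knot s) (hi s) (deg s)"

lemma bspline_extended:
  assumes "j \<in> {1..nspl s}"
  shows "bspline (knot s) (hi s) (deg s) j = bs j"
proof -
  have "bspline_rec (knot s) (deg s) j = bspline_rec (extended_knot s) (deg s) j"
    using assms by (intro bspline_rec_cong extended_knot_eq[symmetric]) auto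
  then show ?thesis by (intro ext) (simp add: bspline_def)
qed

definition denom :: "real \<Rightarrow> real" where
  "denom x = (\<Sum>i=1..nspl s. weight s i * bs i x)"

lemma nurbs_eq: "j \<in> {1..nspl s} \<Longrightarrow> nurbs s j x = weight s j * bs j x / denom x"
proof -
  assume "j \<in> {1..nspl s}"
  moreover have "(\<Sum>i=1..nspl s. weight s i * bspline (knot s) (hi s) (deg s) i x) = denom x"
    unfolding denom_def by (intro sum.cong refl) (simp only: bspline_extended)
  ultimately show ?thesis by (simp only: nurbs_def bspline_extended)
qed

lemma weight_pos: "j \<in> {1..nspl s} \<Longrightarrow> weight s j > 0"
  using valid by (simp add: valid_segment_def)

text \<open>
  The B-splines are non-negative and sum to one, so one of them is positive at \<open>x\<close>.
\<close>

lemma denom_pos: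
  assumes x: "x \<in> {lo s..hi s}"
  shows "denom x > 0"
proof -
  have "\<exists>i\<in>{1..nspl s}. bs i x \<noteq> 0"
  proof (rule ccontr)
    assume "\<not> ?thesis"
    then have "(\<Sum>i=1..nspl s. bs i x) = 0" by simp
    then show False using bspline_sum[OF x] by simp
  qed
  then obtain i where i: "i \<in> {1..nspl s}" "bs i x \<noteq> 0" by blast
  then have "bs i x > 0" using bspline_nonneg[OF x, of i] by simp
  then show ?thesis unfolding denom_def
    using i weight_pos bspline_nonneg[OF x]
    by (intro sum_pos2[of _ i] mult_pos_pos mult_nonneg_nonneg less_imp_le[OF weight_pos]) auto
qed

lemma nurbs_nonneg: "x \<in> {lo s..hi s} \<Longrightarrow> j \<in> {1..nspl s} \<Longrightarrow> nurbs s j x \<ge> 0"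
  using denom_pos[of x] weight_pos[of j] bspline_nonneg[of x j] by (simp add: nurbs_eq)

lemma nurbs_sum: "x \<in> {lo s..hi s} \<Longrightarrow> (\<Sum>j=1..nspl s. nurbs s j x) = 1"
proof -
  assume x: "x \<in> {lo s..hi s}"
  have "(\<Sum>j=1..nspl s. nurbs s j x) = (\<Sum>j=1..nspl s. weight s j * bs j x / denom x)"
    by (intro sum.cong refl nurbs_eq)
  also have "\<dots> = denom x / denom x" by (simp only: sum_divide_distrib[symmetric] denom_def)
  also have "\<dots> = 1" using denom_pos[OF x] by simp
  finally show ?thesis .
qed

lemma nurbs_lin_indep:
  assumes zero: "\<And>x. x \<in> {lo s..<hi s} \<Longrightarrow> (\<Sum>j=1..nspl s. c j * nurbs s j x) = 0"
    and j: "j \<in> {1..nspl s}"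
  shows "c j = 0"
proof -
  have "c j * weight s j = 0"
  proof (rule bspline_lin_indep[OF _ j])
    fix x assume x: "x \<in> {lo s..<hi s}"
    have "(\<Sum>i=1..nspl s. c i * weight s i * bs i x) = denom x * (\<Sum>i=1..nspl s. c i * nurbs s i x)"
      unfolding sum_distrib_left
    proof (intro sum.cong refl)
      fix i assume "i \<in> {1..nspl s}"
      then show "c i * weight s i * bs i x = denom x * (c i * nurbs s i x)"
        using denom_pos[of x] x by (simp add: nurbs_eq)
    qed
    then show "(\<Sum>i=1..nspl s. c i * weight s i * bs i x) = 0" using zero[OF x] by simp
  qed
  then show ?thesis using weight_pos[OF j] by simp
qed

lemma denom_lo: "denom (lo s) = weight s 1"
  unfolding denom_def bspline_at_a using deg_less by (intro sum_mult_delta) simp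

lemma denom_hi: "denom (hi s) = weight s (nspl s)"
proof -
  have "denom (hi s) = (\<Sum>i=1..nspl s. weight s i * (if i = nspl s then 1 else 0))"
    by (simp add: denom_def bspline_at_b)
  also have "\<dots> = weight s (nspl s)" using deg_less by (intro sum_mult_delta) simp
  finally show ?thesis .
qed

lemma nurbs_at_lo: "j \<in> {1..nspl s} \<Longrightarrow> nurbs s j (lo s) = (if j = 1 then 1 else 0)"
  using weight_pos[of 1] deg_less by (auto simp: nurbs_eq denom_lo bspline_at_a)

lemma nurbs_at_hi: "j \<in> {1..nspl s} \<Longrightarrow> nurbs s j (hi s) = (if j = nspl s then 1 else 0)"
  using weight_pos[of "nspl s"] by (auto simp: nurbs_eq denom_hi bspline_at_b)

definition denom_deriv :: "real \<Rightarrow> real" where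
  "denom_deriv x = (\<Sum>i=1..nspl s. weight s i * bspline_deriv i x)"

definition nurbs_deriv :: "nat \<Rightarrow> real \<Rightarrow> real" where
  "nurbs_deriv j x =
     weight s j * (bspline_deriv j x * denom x - bs j x * denom_deriv x) / (denom x)\<^sup>2"

lemma denom_has_derivative: "(denom has_real_derivative denom_deriv x) (at x within {lo s..hi s})"
  unfolding denom_def[abs_def] denom_deriv_def
  by (intro DERIV_sum DERIV_cmult bspline_has_derivative)

lemma denom_continuous: "continuous_on {lo s..hi s} denom"
  using denom_has_derivative by (intro DERIV_continuous_on)

lemma nurbs_deriv_continuous: "continuous_on {lo s..hi s} (nurbs_deriv j)"
  unfolding nurbs_deriv_def[abs_def] denom_deriv_def
  by (intro continuous_intros bspline_deriv_continuous denom_continuous bspline_continuous)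
     (use denom_pos in force)+

lemma nurbs_has_derivative:
  assumes "j \<in> {1..nspl s}" "x \<in> {lo s..hi s}"
  shows "(nurbs s j has_real_derivative nurbs_deriv j x) (at x within {lo s..hi s})"
proof -
  have ne: "denom x \<noteq> 0" using denom_pos[OF assms(2)] by simp
  have "((\<lambda>x. weight s j * bs j x / denom x) has_real_derivative
      (weight s j * bspline_deriv j x * denom x - weight s j * bs j x * denom_deriv x) / (denom x * denom x))
      (at x within {lo s..hi s})"
    by (intro DERIV_divide DERIV_cmult bspline_has_derivative denom_has_derivative ne)
  moreover have "nurbs s j = (\<lambda>x. weight s j * bs j x / denom x)"
    using assms(1) by (intro ext) (rule nurbs_eq)
  ultimately show ?thesis
    by (simp add: nurbs_deriv_def power2_eq_square right_diff_distrib mult.assoc)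
qed

text \<open>
  The slopes of the second NURBS at the left end and of the last NURBS at the right end; the
  theorem calls them \<open>\<beta>\<close> and \<open>\<alpha>\<close>.
\<close>

definition left_slope :: real where
  "left_slope = real (deg s) / (knot s (deg s + 2) - lo s) * (weight s 2 / weight s 1)"

definition right_slope :: real where
  "right_slope = real (deg s) / (hi s - knot s (nspl s)) * (weight s (nspl s - 1) / weight s (nspl s))"

lemma slopes_pos: "left_slope > 0" "right_slope > 0"
  using left_multiplicity right_multiplicity deg_ge_2 deg_less weight_pos
  by (auto simp: left_slope_def right_slope_def extended_knot_eq intro!: mult_pos_pos divide_pos_pos)

lemma nurbs_deriv_at_lo:
  assumes "j \<in> {1..nspl s}"
  shows "nurbs_deriv j (lo s) = left_slope * ((if j = 2 then 1 else 0) - (if j = 1 then 1 else 0))"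
proof -
  define \<delta> where "\<delta> = real (deg s) / (knot s (deg s + 2) - lo s)"
  have d: "bspline_deriv i (lo s) = \<delta> * ((if i = 2 then 1 else 0) - (if i = 1 then 1 else 0))" for i
    using deg_less by (simp add: bspline_deriv_at_a \<delta>_def extended_knot_eq)
  have "denom_deriv (lo s) = \<delta> * ((\<Sum>i=1..nspl s. weight s i * (if i = 2 then 1 else 0)) -
      (\<Sum>i=1..nspl s. weight s i * (if i = 1 then 1 else 0)))"
    by (simp only: denom_deriv_def d sum_distrib_left sum_subtractf[symmetric])
       (simp add: algebra_simps)
  also have "\<dots> = \<delta> * (weight s 2 - weight s 1)"
    using deg_less deg_ge_2 by (subst (1 2) sum_mult_delta) auto
  finally have dd: "denom_deriv (lo s) = \<delta> * (weight s 2 - weight s 1)" .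
  have w: "weight s 1 > 0" using weight_pos[of 1] deg_less by simp
  have "nurbs_deriv j (lo s) = \<delta> * (weight s 2 / weight s 1) * ((if j = 2 then 1 else 0) - (if j = 1 then 1 else 0))"
    unfolding nurbs_deriv_def dd d denom_lo bspline_at_a using w
    by (auto simp: field_simps power2_eq_square)
  then show ?thesis by (simp add: left_slope_def \<delta>_def)
qed

lemma nurbs_deriv_at_hi:
  assumes "j \<in> {1..nspl s}"
  shows "nurbs_deriv j (hi s) = right_slope * ((if j = nspl s then 1 else 0) - (if j = nspl s - 1 then 1 else 0))"
proof -
  define \<delta> where "\<delta> = real (deg s) / (hi s - knot s (nspl s))"
  have d: "bspline_deriv i (hi s) = \<delta> * ((if i = nspl s then 1 else 0) - (if i = nspl s - 1 then 1 else 0))" for i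
  proof -
    have "i + 1 = nspl s \<longleftrightarrow> i = nspl s - 1" using deg_less by auto
    then show ?thesis using deg_less by (simp only: bspline_deriv_at_b \<delta>_def) (simp add: extended_knot_eq)
  qed
  have "denom_deriv (hi s) = \<delta> * ((\<Sum>i=1..nspl s. weight s i * (if i = nspl s then 1 else 0)) -
      (\<Sum>i=1..nspl s. weight s i * (if i = nspl s - 1 then 1 else 0)))"
    by (simp only: denom_deriv_def d sum_distrib_left sum_subtractf[symmetric])
       (simp add: algebra_simps)
  also have "\<dots> = \<delta> * (weight s (nspl s) - weight s (nspl s - 1))"
    using deg_less deg_ge_2 by (subst (1 2) sum_mult_delta) auto
  finally have dd: "denom_deriv (hi s) = \<delta> * (weight s (nspl s) - weight s (nspl s - 1))" .
  have w: "weight s (nspl s) > 0" using weight_pos[of "nspl s"] deg_less by simp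
  have e: "bs j (hi s) = (if j = nspl s then 1 else 0)" by (simp add: bspline_at_b)
  have "nurbs_deriv j (hi s) = \<delta> * (weight s (nspl s - 1) / weight s (nspl s)) *
      ((if j = nspl s then 1 else 0) - (if j = nspl s - 1 then 1 else 0))"
    unfolding nurbs_deriv_def dd d denom_hi e using w deg_less
    by (auto simp: field_simps power2_eq_square)
  then show ?thesis by (simp add: right_slope_def \<delta>_def)
qed

end

section \<open>Joining the segments\<close>

text \<open>
  Functions \<open>g i\<close> on the segments are transported to \<open>\<Omega>\<close> with the same half-open convention as in the
  local basis, so that combinations of the local basis are joined functions, and so are their derivatives.
\<close>

definition joined :: "nat \<Rightarrow> (nat \<Rightarrow> segment) \<Rightarrow> real \<Rightarrow> (nat \<Rightarrow> real \<Rightarrow> real) \<Rightarrow> real \<Rightarrow> real" where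
  "joined m S \<tau> g t = (\<Sum>i=1..m.
     if t \<in> {tau1 S \<tau> i..<tau2 S \<tau> i} \<or> (i = m \<and> t = t_end m S \<tau>)
     then g i (inv (phi S \<tau> i) t) else 0)"

lemma mu_step: "i \<ge> 1 \<Longrightarrow> mu S i = mu S (i-1) + nspl (S i)"
  by (cases i) (simp_all add: mu_def)

lemma sum_mu:
  "(\<Sum>k=1..mu S m. f k) = (\<Sum>i=1..m. \<Sum>j=1..nspl (S i). f (mu S (i-1) + j))"
proof (induction m)
  case 0
  then show ?case by (simp add: mu_def)
next
  case (Suc m)
  have "(\<Sum>k=1..mu S (Suc m). f k) = (\<Sum>k=1..mu S m + nspl (S (Suc m)). f k)"
    by (simp add: mu_step)
  also have "\<dots> = (\<Sum>k=1..mu S m. f k) + (\<Sum>k=1+mu S m..nspl (S (Suc m)) + mu S m. f k)"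
    by (subst sum.ub_add_nat) (simp_all add: add.commute)
  also have "(\<Sum>k=1+mu S m..nspl (S (Suc m)) + mu S m. f k) = (\<Sum>j=1..nspl (S (Suc m)). f (j + mu S m))"
    by (rule sum.shift_bounds_cl_nat_ivl)
  finally show ?case using Suc by (simp add: add.commute)
qed

lemma mu_index_obtain:
  assumes "k \<in> {1..mu S m}"
  obtains i j where "i \<in> {1..m}" "j \<in> {1..nspl (S i)}" "k = mu S (i-1) + j"
  using assms
proof (induction m arbitrary: thesis)
  case 0
  then show ?case by (simp add: mu_def)
next
  case (Suc m)
  show ?case
  proof (cases "k \<le> mu S m")
    case True
    then have "k \<in> {1..mu S m}" using Suc.prems(2) by simp
    then show ?thesis using Suc.IH Suc.prems(1) by (metis atLeastAtMost_iff le_Suc_eq)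
  next
    case False
    then show ?thesis
      using Suc.prems mu_step[of "Suc m" S] by (intro Suc.prems(1)[of "Suc m" "k - mu S m"]) auto
  qed
qed

lemma phi_eq: "phi S \<tau> i x = tau1 S \<tau> i + (x - lo (S i))"
  by (simp add: phi_def tau1_def)

lemma inv_phi: "inv (phi S \<tau> i) t = t - tau1 S \<tau> i + lo (S i)"
proof -
  have "inj (phi S \<tau> i)" by (rule injI) (simp add: phi_eq)
  moreover have "phi S \<tau> i (t - tau1 S \<tau> i + lo (S i)) = t" by (simp add: phi_eq)
  ultimately show ?thesis by (rule inv_f_eq)
qed

locale multi_segment =
  fixes m :: nat and S :: "nat \<Rightarrow> segment" and \<tau> :: real
  assumes segments: "m \<ge> 1" and all_valid: "\<forall>i\<in>{1..m}. valid_segment (S i)"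
begin

lemma seg: "i \<in> {1..m} \<Longrightarrow> nurbs_segment (S i)"
  using all_valid by (simp add: nurbs_segment_def)

lemma nspl_ge_3: "i \<in> {1..m} \<Longrightarrow> 3 \<le> nspl (S i)"
  using nurbs_segment.deg_less_nspl[OF seg] all_valid by (force simp: valid_segment_def)

lemma lo_less_hi: "i \<in> {1..m} \<Longrightarrow> lo (S i) < hi (S i)"
  using all_valid by (auto simp: valid_segment_def)

lemma tau2_eq: "tau2 S \<tau> i = tau1 S \<tau> i + (hi (S i) - lo (S i))"
  by (simp add: tau2_def phi_eq)

lemma tau1_less_tau2: "i \<in> {1..m} \<Longrightarrow> tau1 S \<tau> i < tau2 S \<tau> i"
  using lo_less_hi[of i] by (simp add: tau2_eq)

lemma tau2_le_tau1:
  assumes "1 \<le> i" "i < k" "k \<le> m"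
  shows "tau2 S \<tau> i \<le> tau1 S \<tau> k"
proof -
  have "Suc i \<le> k" using assms by simp
  then show ?thesis using assms(3)
  proof (induction k rule: dec_induct)
    case base
    then show ?case using tau1_Suc[of i S \<tau>] assms by simp
  next
    case (step k)
    then show ?case using tau1_less_tau2[of k] tau1_Suc[of k S \<tau>] by simp
  qed
qed

lemma tau2_le_t_end: "i \<in> {1..m} \<Longrightarrow> tau2 S \<tau> i \<le> t_end m S \<tau>"
  using tau2_le_tau1[of i m] tau1_less_tau2[of m] by (cases "i = m") (auto simp: t_end_def)

lemma Omega_interval: "Omega m S \<tau> = {t_start S \<tau>..t_end m S \<tau>}"
  using segments all_valid by (rule Omega_eq)

lemma t_start_less_t_end: "t_start S \<tau> < t_end m S \<tau>"
  using tau1_less_tau2[of 1] tau2_le_t_end[of 1] segments by (simp add: t_start_def)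

lemma phi_in_Omega: "i \<in> {1..m} \<Longrightarrow> x \<in> {lo (S i)..hi (S i)} \<Longrightarrow> phi S \<tau> i x \<in> Omega m S \<tau>"
  unfolding Omega_def by (intro UN_I[of i]) (auto simp: phi_eq tau2_eq)

lemma Omega_cases:
  assumes "t \<in> Omega m S \<tau>"
  obtains i x where "i \<in> {1..m}" "x \<in> {lo (S i)..hi (S i)}" "t = phi S \<tau> i x"
proof -
  obtain i where "i \<in> {1..m}" "t \<in> {tau1 S \<tau> i..tau2 S \<tau> i}" using assms by (auto simp: Omega_def)
  then show ?thesis by (intro that[of i "t - tau1 S \<tau> i + lo (S i)"]) (auto simp: phi_eq tau2_eq)
qed

text \<open>
  The conditions selecting a segment in \<^const>\<open>joined\<close> are mutually exclusive, as a segment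
  ends no later than any following one begins.
\<close>

lemma joined_half_open:
  assumes i: "i \<in> {1..m}" and x: "lo (S i) \<le> x" "x < hi (S i) \<or> (i = m \<and> x = hi (S i))"
  shows "joined m S \<tau> g (phi S \<tau> i x) = g i x"
proof -
  let ?t = "phi S \<tau> i x"
  let ?C = "\<lambda>k. ?t \<in> {tau1 S \<tau> k..<tau2 S \<tau> k} \<or> (k = m \<and> ?t = t_end m S \<tau>)"
  have Ci: "?C i" using x by (auto simp: phi_eq tau2_eq t_end_def)
  have le: "tau1 S \<tau> k \<le> ?t" if "k \<in> {1..m}" "?C k" for k
    using that tau1_less_tau2[of k] by (auto simp: t_end_def)
  have less: False if "k \<in> {1..m}" "l \<in> {1..m}" "k < l" "?C k" "?C l" for k l
  proof -
    have "k \<noteq> m" using that by auto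
    then have "?t < tau2 S \<tau> k" using that by auto
    also have "\<dots> \<le> tau1 S \<tau> l" using that by (intro tau2_le_tau1) auto
    also have "\<dots> \<le> ?t" using that by (intro le)
    finally show False by simp
  qed
  have "\<not> ?C k" if "k \<in> {1..m}" "k \<noteq> i" for k
    using less[OF that(1) i] less[OF i that(1)] Ci that(2) by (metis linorder_neqE_nat)
  then have "joined m S \<tau> g ?t = (\<Sum>k=1..m. if k = i then g i (inv (phi S \<tau> i) ?t) else 0)"
    unfolding joined_def using Ci by (intro sum.cong) auto
  also have "\<dots> = g i x" using i by (simp add: inv_phi phi_eq)
  finally show ?thesis .
qed

definition matching :: "(nat \<Rightarrow> real \<Rightarrow> real) \<Rightarrow> bool" where
  "matching g \<longleftrightarrow> (\<forall>i\<in>{1..<m}. g i (hi (S i)) = g (i+1) (lo (S (i+1))))"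

lemma joined_closed:
  assumes "matching g" and i: "i \<in> {1..m}" and x: "x \<in> {lo (S i)..hi (S i)}"
  shows "joined m S \<tau> g (phi S \<tau> i x) = g i x"
proof (cases "x < hi (S i) \<or> i = m")
  case True
  then show ?thesis using x i by (intro joined_half_open) auto
next
  case False
  then have x: "x = hi (S i)" and i': "i \<in> {1..<m}" using x i by auto
  have "phi S \<tau> i x = phi S \<tau> (i+1) (lo (S (i+1)))"
    using tau1_Suc[of i S \<tau>] i' unfolding x by (simp add: tau1_def tau2_def)
  then have "joined m S \<tau> g (phi S \<tau> i x) = g (i+1) (lo (S (i+1)))"
    using i' lo_less_hi[of "i+1"] by (simp add: joined_half_open)
  then show ?thesis using assms(1) i' x by (simp add: matching_def)
qed

lemma joined_continuous:
  assumes "matching g" "\<And>i. i \<in> {1..m} \<Longrightarrow> continuous_on {lo (S i)..hi (S i)} (g i)"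
  shows "continuous_on (Omega m S \<tau>) (joined m S \<tau> g)"
  unfolding Omega_def
proof (intro continuous_on_closed_Union)
  fix i assume i: "i \<in> {1..m}"
  have "continuous_on {tau1 S \<tau> i..tau2 S \<tau> i} (\<lambda>t. g i (t - tau1 S \<tau> i + lo (S i)))"
    by (rule continuous_on_compose2[OF assms(2)[OF i]]) (auto intro!: continuous_intros simp: tau2_eq)
  then show "continuous_on {tau1 S \<tau> i..tau2 S \<tau> i} (joined m S \<tau> g)"
  proof (rule continuous_on_eq)
    fix t assume "t \<in> {tau1 S \<tau> i..tau2 S \<tau> i}"
    then show "g i (t - tau1 S \<tau> i + lo (S i)) = joined m S \<tau> g t"
      using joined_closed[OF assms(1) i, of "t - tau1 S \<tau> i + lo (S i)"]
      by (simp add: phi_eq tau2_eq)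
  qed
qed auto

lemma joined_has_derivative:
  assumes "matching g" "matching g'"
    and "\<And>i x. i \<in> {1..m} \<Longrightarrow> x \<in> {lo (S i)..hi (S i)} \<Longrightarrow>
      (g i has_real_derivative g' i x) (at x within {lo (S i)..hi (S i)})"
  shows "(joined m S \<tau> g has_real_derivative joined m S \<tau> g' t) (at t within Omega m S \<tau>)"
  unfolding Omega_def
proof (rule has_field_derivative_within_closed_Union)
  fix i assume i: "i \<in> {1..m}" and t: "t \<in> {tau1 S \<tau> i..tau2 S \<tau> i}"
  let ?h = "\<lambda>t. t - tau1 S \<tau> i + lo (S i)"
  let ?I = "{tau1 S \<tau> i..tau2 S \<tau> i}"
  have h: "?h u \<in> {lo (S i)..hi (S i)}" if "u \<in> ?I" for u using that by (simp add: tau2_eq)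
  have joined: "joined m S \<tau> f u = f i (?h u)" if "matching f" "u \<in> ?I" for f u
    using joined_closed[OF that(1) i h[OF that(2)]] by (simp add: phi_eq)
  have "(g i has_real_derivative g' i (?h t)) (at (?h t) within ?h ` ?I)"
    using assms(3)[OF i h[OF t]] by (rule DERIV_subset) (use h in blast)
  moreover have "(?h has_real_derivative 1) (at t within ?I)"
    by (auto intro!: derivative_eq_intros)
  ultimately have "(g i \<circ> ?h has_real_derivative g' i (?h t) * 1) (at t within ?I)"
    by (rule DERIV_image_chain)
  then have "(g i \<circ> ?h has_real_derivative joined m S \<tau> g' t) (at t within ?I)"
    using joined[OF assms(2) t] by simp
  then show "(joined m S \<tau> g has_real_derivative joined m S \<tau> g' t) (at t within ?I)"
    by (rule has_field_derivative_transform_within[of _ _ _ _ 1]) (use t joined[OF assms(1)] in auto)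
qed auto

definition seg_sum :: "(nat \<Rightarrow> real) \<Rightarrow> nat \<Rightarrow> real \<Rightarrow> real" where
  "seg_sum d i x = (\<Sum>j=1..nspl (S i). d (mu S (i-1) + j) * nurbs (S i) j x)"

definition seg_sum_deriv :: "(nat \<Rightarrow> real) \<Rightarrow> nat \<Rightarrow> real \<Rightarrow> real" where
  "seg_sum_deriv d i x =
     (\<Sum>j=1..nspl (S i). d (mu S (i-1) + j) * nurbs_segment.nurbs_deriv (S i) j x)"

definition combination :: "(nat \<Rightarrow> real) \<Rightarrow> real \<Rightarrow> real" where
  "combination d t = (\<Sum>k=1..mu S m. d k * local_basis m S \<tau> k t)"

lemma combination_eq_joined: "combination d = joined m S \<tau> (seg_sum d)"
proof (rule ext)
  fix t
  have "combination d t = (\<Sum>i=1..m. \<Sum>j=1..nspl (S i).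
      d (mu S (i-1) + j) * local_basis m S \<tau> (mu S (i-1) + j) t)"
    unfolding combination_def by (rule sum_mu)
  also have "\<dots> = (\<Sum>i=1..m. \<Sum>j=1..nspl (S i). d (mu S (i-1) + j) * seg_nurbs m S \<tau> i j t)"
  proof (intro sum.cong refl)
    fix i j assume "i \<in> {1..m}" "j \<in> {1..nspl (S i)}"
    then show "d (mu S (i-1) + j) * local_basis m S \<tau> (mu S (i-1) + j) t =
        d (mu S (i-1) + j) * seg_nurbs m S \<tau> i j t"
      using local_basis_eq[of i j S m \<tau>] by simp
  qed
  also have "\<dots> = joined m S \<tau> (seg_sum d) t"
    unfolding joined_def seg_sum_def seg_nurbs_def by (intro sum.cong refl) (auto intro!: sum.neutral)
  finally show "combination d t = joined m S \<tau> (seg_sum d) t" .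
qed

lemma seg_sum_at_lo:
  assumes i: "i \<in> {1..m}"
  shows "seg_sum d i (lo (S i)) = d (mu S (i-1) + 1)"
proof -
  have "seg_sum d i (lo (S i)) = (\<Sum>j=1..nspl (S i). d (mu S (i-1) + j) * (if j = 1 then 1 else 0))"
    unfolding seg_sum_def
    by (intro sum.cong refl arg_cong2[of _ _ _ _ "(*)"] nurbs_segment.nurbs_at_lo seg i)
  then show ?thesis using nspl_ge_3[OF i] by (subst (asm) sum_mult_delta) auto
qed

lemma seg_sum_at_hi:
  assumes i: "i \<in> {1..m}"
  shows "seg_sum d i (hi (S i)) = d (mu S i)"
proof -
  have "seg_sum d i (hi (S i)) =
      (\<Sum>j=1..nspl (S i). d (mu S (i-1) + j) * (if j = nspl (S i) then 1 else 0))"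
    unfolding seg_sum_def
    by (intro sum.cong refl arg_cong2[of _ _ _ _ "(*)"] nurbs_segment.nurbs_at_hi seg i)
  then show ?thesis
    using nspl_ge_3[OF i] mu_step[of i S] i by (subst (asm) sum_mult_delta) auto
qed

lemma seg_sum_deriv_at_lo:
  assumes i: "i \<in> {1..m}"
  shows "seg_sum_deriv d i (lo (S i)) =
    nurbs_segment.left_slope (S i) * (d (mu S (i-1) + 2) - d (mu S (i-1) + 1))"
proof -
  have "seg_sum_deriv d i (lo (S i)) = (\<Sum>j=1..nspl (S i). d (mu S (i-1) + j) *
      (nurbs_segment.left_slope (S i) * ((if j = 2 then 1 else 0) - (if j = 1 then 1 else 0))))"
    unfolding seg_sum_deriv_def
    by (intro sum.cong refl arg_cong2[of _ _ _ _ "(*)"] nurbs_segment.nurbs_deriv_at_lo seg i)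
  also have "\<dots> = nurbs_segment.left_slope (S i) * (d (mu S (i-1) + 2) - d (mu S (i-1) + 1))"
    using nspl_ge_3[OF i] by (intro sum_mult_delta_diff) auto
  finally show ?thesis .
qed

lemma seg_sum_deriv_at_hi:
  assumes i: "i \<in> {1..m}"
  shows "seg_sum_deriv d i (hi (S i)) = alpha S i * (d (mu S i) - d (mu S i - 1))"
proof -
  have "seg_sum_deriv d i (hi (S i)) = (\<Sum>j=1..nspl (S i). d (mu S (i-1) + j) *
      (nurbs_segment.right_slope (S i) *
        ((if j = nspl (S i) then 1 else 0) - (if j = nspl (S i) - 1 then 1 else 0))))"
    unfolding seg_sum_deriv_def
    by (intro sum.cong refl arg_cong2[of _ _ _ _ "(*)"] nurbs_segment.nurbs_deriv_at_hi seg i)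
  also have "\<dots> = nurbs_segment.right_slope (S i) *
      (d (mu S (i-1) + nspl (S i)) - d (mu S (i-1) + (nspl (S i) - 1)))"
    using nspl_ge_3[OF i] by (intro sum_mult_delta_diff) auto
  also have "mu S (i-1) + nspl (S i) = mu S i" using mu_step[of i S] i by simp
  also have "mu S (i-1) + (nspl (S i) - 1) = mu S i - 1"
    using mu_step[of i S] nspl_ge_3[OF i] i by simp
  also have "nurbs_segment.right_slope (S i) = alpha S i"
    by (simp add: nurbs_segment.right_slope_def[OF seg[OF i]] alpha_def Let_def)
  finally show ?thesis .
qed

lemma next_seg_range: "i \<in> {1..m} \<Longrightarrow> next_seg m i \<in> {1..m}"
  using segments by (auto simp: next_seg_def)

lemma left_slope_eq_beta: "i \<in> {1..m} \<Longrightarrow> nurbs_segment.left_slope (S (next_seg m i)) = beta m S i"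
  by (simp add: nurbs_segment.left_slope_def[OF seg[OF next_seg_range]] beta_def Let_def)

lemma alpha_pos: "i \<in> {1..m} \<Longrightarrow> alpha S i > 0"
  using nurbs_segment.slopes_pos(2)[OF seg[of i]]
  by (simp add: nurbs_segment.right_slope_def[OF seg] alpha_def Let_def)

lemma beta_pos: "i \<in> {1..m} \<Longrightarrow> beta m S i > 0"
  using nurbs_segment.slopes_pos(1)[OF seg[OF next_seg_range]] by (simp add: left_slope_eq_beta)

text \<open>
  Positions \<open>mu S i - 1\<close> and \<open>mu S i\<close> are the last two of segment \<open>i\<close>, and the next two positions are the
  first two of segment \<open>i + 1\<close>; only these four functions contribute to value and derivative at the
  junction. The two conditions say that value and derivative of the combination match there.
\<close>

definition smooth_coeffs :: "(nat \<Rightarrow> real) \<Rightarrow> bool" where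
  "smooth_coeffs d \<longleftrightarrow> (\<forall>i\<in>{1..<m}. d (mu S i) = d (mu S i + 1) \<and>
     alpha S i * (d (mu S i) - d (mu S i - 1)) = beta m S i * (d (mu S i + 2) - d (mu S i + 1)))"

definition periodic_coeffs :: "(nat \<Rightarrow> real) \<Rightarrow> bool" where
  "periodic_coeffs d \<longleftrightarrow> d (mu S m) = d 1 \<and>
     alpha S m * (d (mu S m) - d (mu S m - 1)) = beta m S m * (d 2 - d 1)"

lemma matching_seg_sum:
  assumes "smooth_coeffs d"
  shows "matching (seg_sum d)" "matching (seg_sum_deriv d)"
proof -
  show "matching (seg_sum d)"
    unfolding matching_def
  proof
    fix i assume "i \<in> {1..<m}"
    then show "seg_sum d i (hi (S i)) = seg_sum d (i+1) (lo (S (i+1)))"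
      using seg_sum_at_hi[of i d] seg_sum_at_lo[of "i+1" d] assms by (simp add: smooth_coeffs_def)
  qed
  show "matching (seg_sum_deriv d)"
    unfolding matching_def
  proof
    fix i assume i: "i \<in> {1..<m}"
    then have "alpha S i * (d (mu S i) - d (mu S i - 1)) = beta m S i * (d (mu S i + 2) - d (mu S i + 1))"
      using assms unfolding smooth_coeffs_def by blast
    with i show "seg_sum_deriv d i (hi (S i)) = seg_sum_deriv d (i+1) (lo (S (i+1)))"
      using left_slope_eq_beta[of i]
      by (simp add: seg_sum_deriv_at_hi seg_sum_deriv_at_lo next_seg_def)
  qed
qed

lemma combination_eq_seg_sum:
  "smooth_coeffs d \<Longrightarrow> i \<in> {1..m} \<Longrightarrow> x \<in> {lo (S i)..hi (S i)} \<Longrightarrow>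
     combination d (phi S \<tau> i x) = seg_sum d i x"
  unfolding combination_eq_joined by (intro joined_closed matching_seg_sum)

lemma combination_has_derivative:
  assumes "smooth_coeffs d"
  shows "(combination d has_real_derivative joined m S \<tau> (seg_sum_deriv d) t) (at t within Omega m S \<tau>)"
  unfolding combination_eq_joined
proof (rule joined_has_derivative[OF matching_seg_sum[OF assms]])
  fix i x assume i: "i \<in> {1..m}" "x \<in> {lo (S i)..hi (S i)}"
  show "(seg_sum d i has_real_derivative seg_sum_deriv d i x) (at x within {lo (S i)..hi (S i)})"
    unfolding seg_sum_def[abs_def] seg_sum_deriv_def
    by (intro DERIV_sum DERIV_cmult nurbs_segment.nurbs_has_derivative seg i)
qed

lemma combination_vector_derivative:
  assumes "smooth_coeffs d" "t \<in> Omega m S \<tau>"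
  shows "vector_derivative (combination d) (at t within Omega m S \<tau>) = joined m S \<tau> (seg_sum_deriv d) t"
proof -
  have "(combination d has_vector_derivative joined m S \<tau> (seg_sum_deriv d) t)
      (at t within {t_start S \<tau>..t_end m S \<tau>})"
    using combination_has_derivative[OF assms(1), of t]
    by (simp add: has_real_derivative_iff_has_vector_derivative Omega_interval)
  then show ?thesis
    using t_start_less_t_end assms(2) unfolding Omega_interval
    by (intro vector_derivative_within_cbox[of "t_start S \<tau>" "t_end m S \<tau>", unfolded cbox_interval])
qed

lemma combination_in_spline_space:
  assumes "smooth_coeffs d"
  shows "combination d \<in> spline_space m S \<tau>"
proof -
  have "combination d differentiable_on Omega m S \<tau>"
    unfolding differentiable_on_def
    using combination_has_derivative[OF assms] has_field_derivative_imp_has_derivative differentiableI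
    by blast
  moreover have "continuous_on (Omega m S \<tau>) (joined m S \<tau> (seg_sum_deriv d))"
  proof (rule joined_continuous[OF matching_seg_sum(2)[OF assms]])
    fix i assume i: "i \<in> {1..m}"
    show "continuous_on {lo (S i)..hi (S i)} (seg_sum_deriv d i)"
      unfolding seg_sum_deriv_def[abs_def]
      by (intro continuous_intros nurbs_segment.nurbs_deriv_continuous seg i)
  qed
  then have "continuous_on (Omega m S \<tau>)
      (\<lambda>t. vector_derivative (combination d) (at t within Omega m S \<tau>))"
    by (rule continuous_on_eq) (simp add: combination_vector_derivative assms)
  moreover have "combination d \<circ> phi S \<tau> i \<in> nurbs_space (S i)" if "i \<in> {1..m}" for i
    unfolding nurbs_space_def
    using combination_eq_seg_sum[OF assms that]
    by (intro CollectI exI[of _ "\<lambda>j. d (mu S (i-1) + j)"]) (simp add: seg_sum_def)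
  ultimately show ?thesis by (simp add: spline_space_def C1_on_def)
qed

lemma combination_in_per_spline_space:
  assumes d: "smooth_coeffs d" "periodic_coeffs d"
  shows "combination d \<in> per_spline_space m S \<tau>"
proof -
  have m1: "1 \<in> {1..m}" "m \<in> {1..m}" using segments by auto
  have t: "t_start S \<tau> = phi S \<tau> 1 (lo (S 1))" "t_end m S \<tau> = phi S \<tau> m (hi (S m))"
    by (simp_all add: t_start_def t_end_def tau1_def tau2_def)
  have ends: "lo (S 1) \<in> {lo (S 1)..hi (S 1)}" "hi (S m) \<in> {lo (S m)..hi (S m)}"
    using lo_less_hi m1 by (auto intro: less_imp_le)
  have \<Omega>: "t_start S \<tau> \<in> Omega m S \<tau>" "t_end m S \<tau> \<in> Omega m S \<tau>"
    using t_start_less_t_end by (auto simp: Omega_interval)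
  have mu0: "mu S 0 = 0" by (simp add: mu_def)
  have "combination d (t_start S \<tau>) = combination d (t_end m S \<tau>)"
    using d m1 ends seg_sum_at_lo[of 1 d] seg_sum_at_hi[of m d]
    by (simp add: t combination_eq_seg_sum periodic_coeffs_def mu0)
  moreover have "joined m S \<tau> (seg_sum_deriv d) (t_start S \<tau>) = joined m S \<tau> (seg_sum_deriv d) (t_end m S \<tau>)"
  proof -
    have "joined m S \<tau> (seg_sum_deriv d) (t_start S \<tau>) = beta m S m * (d 2 - d 1)"
      using m1(1) ends(1) seg_sum_deriv_at_lo[OF m1(1), of d] left_slope_eq_beta[OF m1(2)]
      by (simp add: t joined_closed matching_seg_sum d(1) mu0 next_seg_def numeral_2_eq_2)
    also have "\<dots> = alpha S m * (d (mu S m) - d (mu S m - 1))"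
      by (rule sym, rule conjunct2[OF d(2)[unfolded periodic_coeffs_def]])
    also have "\<dots> = joined m S \<tau> (seg_sum_deriv d) (t_end m S \<tau>)"
      using m1(2) ends(2) by (simp add: t joined_closed matching_seg_sum d(1) seg_sum_deriv_at_hi)
    finally show ?thesis .
  qed
  ultimately show ?thesis
    using combination_in_spline_space[OF d(1)]
    by (simp add: per_spline_space_def combination_vector_derivative d(1) \<Omega>)
qed

lemma local_basis_lin_indep:
  assumes zero: "\<And>t. t \<in> Omega m S \<tau> \<Longrightarrow> combination d t = 0" and k: "k \<in> {1..mu S m}"
  shows "d k = 0"
proof -
  obtain i j where ij: "i \<in> {1..m}" "j \<in> {1..nspl (S i)}" "k = mu S (i-1) + j"
    using k by (rule mu_index_obtain)
  have "d (mu S (i-1) + j) = 0"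
  proof (rule nurbs_segment.nurbs_lin_indep[OF seg[OF ij(1)] _ ij(2)])
    fix x assume x: "x \<in> {lo (S i)..<hi (S i)}"
    then have "seg_sum d i x = combination d (phi S \<tau> i x)"
      using ij(1) unfolding combination_eq_joined by (intro joined_half_open[symmetric]) auto
    also have "\<dots> = 0" using x ij(1) by (intro zero phi_in_Omega) auto
    finally show "(\<Sum>j=1..nspl (S i). d (mu S (i-1) + j) * nurbs (S i) j x) = 0"
      by (simp only: seg_sum_def)
  qed
  then show ?thesis using ij by simp
qed

lemma local_basis_nonneg:
  assumes "k \<in> {1..mu S m}"
  shows "local_basis m S \<tau> k t \<ge> 0"
proof -
  obtain i j where ij: "i \<in> {1..m}" "j \<in> {1..nspl (S i)}" "k = mu S (i-1) + j"
    using assms by (rule mu_index_obtain)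
  have "seg_nurbs m S \<tau> i j t \<ge> 0"
  proof (cases "t \<in> {tau1 S \<tau> i..<tau2 S \<tau> i} \<or> (i = m \<and> t = t_end m S \<tau>)")
    case True
    then have "t - tau1 S \<tau> i + lo (S i) \<in> {lo (S i)..hi (S i)}"
      using lo_less_hi[OF ij(1)] by (auto simp: tau2_eq t_end_def)
    then have "nurbs (S i) j (t - tau1 S \<tau> i + lo (S i)) \<ge> 0"
      using ij(1,2) by (intro nurbs_segment.nurbs_nonneg seg)
    then show ?thesis by (simp add: seg_nurbs_def inv_phi)
  qed (auto simp: seg_nurbs_def)
  then show ?thesis using local_basis_eq[of i j S m \<tau>] ij by simp
qed

lemma local_basis_sum:
  assumes "t \<in> Omega m S \<tau>"
  shows "(\<Sum>k=1..mu S m. local_basis m S \<tau> k t) = 1"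
proof -
  obtain i x where ix: "i \<in> {1..m}" "x \<in> {lo (S i)..hi (S i)}" "t = phi S \<tau> i x"
    using assms by (rule Omega_cases)
  have "(\<Sum>k=1..mu S m. local_basis m S \<tau> k t) = combination (\<lambda>k. 1) t"
    by (simp add: combination_def)
  also have "\<dots> = seg_sum (\<lambda>k. 1) i x"
    unfolding ix(3) by (intro combination_eq_seg_sum ix) (simp add: smooth_coeffs_def)
  also have "\<dots> = 1" using nurbs_segment.nurbs_sum[OF seg] ix by (simp add: seg_sum_def)
  finally show ?thesis .
qed

end

section \<open>The extraction matrices\<close>

context multi_segment
begin

text \<open>
  The pivot condition makes some column of \<open>M\<close> a unit vector for every row. Linear independence
  follows since, for independent \<open>b\<close>, a relation between the rows of \<open>M b\<close> is a relation between the rows of \<open>M\<close>,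
  and the pivot column of a row contains nothing but the coefficient of that row.
\<close>

lemma spline_family_properties:
  assumes smooth: "\<And>r. r \<in> {1..N} \<Longrightarrow> smooth_coeffs (M r)"
    and nonneg: "\<And>r k. r \<in> {1..N} \<Longrightarrow> k \<in> {1..mu S m} \<Longrightarrow> M r k \<ge> 0"
    and col_sum: "\<And>k. k \<in> {1..mu S m} \<Longrightarrow> (\<Sum>r=1..N. M r k) = 1"
    and pivot: "\<And>r. r \<in> {1..N} \<Longrightarrow>
      \<exists>k\<in>{1..mu S m}. \<forall>r'\<in>{1..N}. M r' k = (if r' = r then 1 else 0)"
    and B: "\<And>r. B r = combination (M r)"
  shows "\<And>r. r \<in> {1..N} \<Longrightarrow> B r \<in> spline_space m S \<tau>"
    and "\<And>r. r \<in> {1..N} \<Longrightarrow> periodic_coeffs (M r) \<Longrightarrow> B r \<in> per_spline_space m S \<tau>"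
    and "lin_indep_on (Omega m S \<tau>) N B"
    and "locally_supported_on (Omega m S \<tau>) N (mu S m) M (local_basis m S \<tau>) B"
    and "convex_partition_of_unity_on (Omega m S \<tau>) N B"
proof -
  show "B r \<in> spline_space m S \<tau>" if "r \<in> {1..N}" for r
    unfolding B using smooth[OF that] by (rule combination_in_spline_space)
  show "B r \<in> per_spline_space m S \<tau>" if "r \<in> {1..N}" "periodic_coeffs (M r)" for r
    unfolding B using smooth[OF that(1)] that(2) by (rule combination_in_per_spline_space)
  have swap: "(\<Sum>r=1..N. c r * B r t) = combination (\<lambda>k. \<Sum>r=1..N. c r * M r k) t" for c t
    unfolding B combination_def sum_distrib_left sum_distrib_right
    by (subst sum.swap) (simp add: mult.assoc)
  show "lin_indep_on (Omega m S \<tau>) N B"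
    unfolding lin_indep_on_def
  proof (intro allI impI ballI)
    fix c r assume zero: "\<forall>t\<in>Omega m S \<tau>. (\<Sum>i=1..N. c i * B i t) = 0" and r: "r \<in> {1..N}"
    obtain k where k: "k \<in> {1..mu S m}" "\<forall>r'\<in>{1..N}. M r' k = (if r' = r then 1 else 0)"
      using pivot[OF r] by blast
    have "0 = (\<Sum>r=1..N. c r * M r k)"
    proof (rule local_basis_lin_indep[OF _ k(1), symmetric])
      fix t assume "t \<in> Omega m S \<tau>"
      then show "combination (\<lambda>k. \<Sum>r=1..N. c r * M r k) t = 0"
        unfolding swap[symmetric] using zero by blast
    qed
    also have "\<dots> = (\<Sum>r'=1..N. c r' * (if r' = r then 1 else 0))"
      using k(2) by (intro sum.cong) auto
    also have "\<dots> = c r" using r by (rule sum_mult_delta)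
    finally show "c r = 0" by simp
  qed
  show "locally_supported_on (Omega m S \<tau>) N (mu S m) M (local_basis m S \<tau>) B"
    unfolding locally_supported_on_def B combination_def
    by (auto simp: support_on_def intro!: sum.neutral)
  show "convex_partition_of_unity_on (Omega m S \<tau>) N B"
    unfolding convex_partition_of_unity_on_def
  proof (intro conjI ballI)
    fix r t assume "r \<in> {1..N}"
    then show "0 \<le> B r t"
      unfolding B combination_def by (intro sum_nonneg mult_nonneg_nonneg nonneg local_basis_nonneg)
  next
    fix t assume t: "t \<in> Omega m S \<tau>"
    have "(\<Sum>r=1..N. B r t) = combination (\<lambda>k. \<Sum>r=1..N. M r k) t"
      using swap[of "\<lambda>r. 1" t] by simp
    also have "\<dots> = (\<Sum>k=1..mu S m. local_basis m S \<tau> k t)"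
      unfolding combination_def using col_sum by (intro sum.cong) auto
    finally show "(\<Sum>r=1..N. B r t) = 1" using local_basis_sum[OF t] by simp
  qed
qed

lemma mu_ge: "i \<le> m \<Longrightarrow> 3 * i \<le> mu S i"
proof (induction i)
  case (Suc i)
  then show ?case using nspl_ge_3[of "Suc i"] mu_step[of "Suc i" S] by simp
qed simp

lemma eta_step:
  assumes "i \<in> {1..m}"
  shows "eta S i = eta S (i-1) + (nspl (S i) - 2)"
  using assms mu_step[of i S] mu_ge[of "i-1"] nspl_ge_3[of i] unfolding eta_def
  by (cases i) auto

lemma eta_mono:
  assumes "i \<le> k" "k \<le> m"
  shows "eta S i \<le> eta S k"
  using assms
proof (induction k rule: dec_induct)
  case (step k)
  then show ?case using eta_step[of "Suc k"] by simp
qed simp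

lemma eta_less:
  assumes "i < k" "k \<le> m"
  shows "eta S i < eta S k"
proof -
  have "eta S i \<le> eta S (k-1)" using assms by (intro eta_mono) auto
  also have "\<dots> < eta S k" using assms eta_step[of k] nspl_ge_3[of k] by simp
  finally show ?thesis .
qed

lemma eta_index_obtain:
  assumes "r \<in> {1..eta S m}"
  obtains i j where "i \<in> {1..m}" "j \<in> {1..nspl (S i) - 2}" "r = eta S (i-1) + j"
proof -
  have "\<exists>i\<in>{1..k}. \<exists>j\<in>{1..nspl (S i) - 2}. r = eta S (i-1) + j" if "k \<le> m" "r \<le> eta S k" for k
    using that
  proof (induction k)
    case 0
    then show ?case using assms by (simp add: eta_def mu_def)
  next
    case (Suc k)
    show ?case
    proof (cases "r \<le> eta S k")
      case True
      then obtain i j where "i \<in> {1..k}" "j \<in> {1..nspl (S i) - 2}" "r = eta S (i-1) + j"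
        using Suc by auto
      then show ?thesis by (intro bexI[of _ i] bexI[of _ j]) auto
    next
      case False
      then show ?thesis
        using Suc.prems eta_step[of "Suc k"] by (intro bexI[of _ "Suc k"] bexI[of _ "r - eta S k"]) auto
    qed
  qed
  from this[of m] assms that show ?thesis by (metis atLeastAtMost_iff order_refl)
qed

lemma mu_index_unique:
  assumes "i \<ge> 1" "k \<ge> 1" "j \<in> {1..nspl (S i)}" "l \<in> {1..nspl (S k)}"
    and "mu S (i-1) + j = mu S (k-1) + l"
  shows "i = k \<and> j = l"
proof -
  have less: False
    if "i < k" "i \<ge> 1" "j \<in> {1..nspl (S i)}" "l \<in> {1..nspl (S k)}" "mu S (i-1) + j = mu S (k-1) + l"
    for i j k l
  proof -
    have "mu S i \<le> mu S (k-1)" using that by (intro mu_mono) simp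
    then show False using that mu_step[of i S] by simp
  qed
  have "\<not> i < k" "\<not> k < i"
    using less[of i k j l] less[of k i l j] assms by auto
  then show ?thesis using assms(5) by simp
qed

text \<open>
  The column that both matrices have at junction \<open>i\<close>, with its two entries in the rows \<open>u\<close> and \<open>v\<close>;
  for \<open>i = m\<close> it belongs to the periodic matrix alone, at the two ends of \<open>\<Omega>\<close>. The two rows may coincide: for a single segment with three functions the periodic basis has just one
  element, and the two entries add up to one.
\<close>

definition junction :: "nat \<Rightarrow> nat \<Rightarrow> nat \<Rightarrow> nat \<Rightarrow> real" where
  "junction i u v r =
     (if r = u then alpha S i / (alpha S i + beta m S i) else 0) +
     (if r = v then beta m S i / (alpha S i + beta m S i) else 0)"

lemma junction_nonneg: "i \<in> {1..m} \<Longrightarrow> junction i u v r \<ge> 0"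
  using alpha_pos[of i] beta_pos[of i] by (simp add: junction_def)

lemma junction_sum:
  assumes "i \<in> {1..m}" "u \<in> {1..N}" "v \<in> {1..N}"
  shows "(\<Sum>r=1..N. junction i u v r) = 1"
proof -
  have "(\<Sum>r=1..N. junction i u v r) =
      alpha S i / (alpha S i + beta m S i) + beta m S i / (alpha S i + beta m S i)"
    using assms(2,3) by (simp add: junction_def sum.distrib)
  also have "\<dots> = 1"
    using alpha_pos[OF assms(1)] beta_pos[OF assms(1)] by (simp add: add_divide_distrib[symmetric])
  finally show ?thesis .
qed

text \<open>
  This is the smoothness condition for a row \<open>r\<close>: next to a junction column with rows \<open>u\<close> and
  \<open>v\<close>, the neighbouring columns are the unit vectors of \<open>u\<close> on the left and of \<open>v\<close> on the right. It is what
  determines the weights \<open>\<alpha> / (\<alpha> + \<beta>)\<close> and \<open>\<beta> / (\<alpha> + \<beta>)\<close>.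
\<close>

lemma junction_balance:
  assumes "i \<in> {1..m}"
  shows "alpha S i * (junction i u v r - (if r = u then 1 else 0)) =
    beta m S i * ((if r = v then 1 else 0) - junction i u v r)"
proof -
  define U V :: real where "U = (if r = u then 1 else 0)" and "V = (if r = v then 1 else 0)"
  have "alpha S i + beta m S i \<noteq> 0" using alpha_pos[OF assms] beta_pos[OF assms] by simp
  then have "(alpha S i + beta m S i) * junction i u v r = alpha S i * U + beta m S i * V"
    by (simp add: junction_def U_def V_def distrib_left)
  then have "alpha S i * (junction i u v r - U) = beta m S i * (V - junction i u v r)"
    by (simp add: algebra_simps)
  then show ?thesis by (simp only: U_def V_def)
qed

lemma last_two_indices:
  assumes "i \<in> {1..m}" "c \<in> {mu S i - 1, mu S i}"
  obtains j where "j \<in> {1..nspl (S i)}" "nspl (S i) - 2 < j" "c = mu S (i-1) + j"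
proof -
  have n3: "3 \<le> nspl (S i)" using nspl_ge_3[OF assms(1)] .
  have step: "mu S i = mu S (i-1) + nspl (S i)" using mu_step[of i S] assms(1) by simp
  consider "c = mu S i" | "c = mu S i - 1" using assms(2) by auto
  then show ?thesis
  proof cases
    case 1
    then show ?thesis using n3 step by (intro that[of "nspl (S i)"]) auto
  next
    case 2
    then show ?thesis using n3 step by (intro that[of "nspl (S i) - 1"]) auto
  qed
qed

text \<open>
  The column index determines the segment and the position in it, so at most one summand of the
  definition survives.
\<close>

lemma Hc_inner:
  assumes i: "i \<in> {1..m}" and j: "j \<in> {1..nspl (S i) - 2}"
  shows "Hc m S r (mu S (i-1) + j) = (if r = eta S (i-1) + j then 1 else 0)"
proof -
  let ?c = "mu S (i-1) + j"
  have uniq: "k = i \<and> l = j" if "k \<in> {1..m}" "l \<in> {1..nspl (S k)}" "?c = mu S (k-1) + l" for k l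
    using mu_index_unique[of i k j l] that i j by auto
  have "(\<Sum>k=1..m. \<Sum>l=1..nspl (S k) - 2. if r = eta S (k-1) + l \<and> ?c = mu S (k-1) + l then 1 else 0)
      = (\<Sum>k=1..m. if k = i then \<Sum>l=1..nspl (S i) - 2. if l = j then
          (if r = eta S (i-1) + j then 1 else 0 :: real) else 0 else 0)"
  proof (intro sum.cong refl)
    fix k assume k: "k \<in> {1..m}"
    show "(\<Sum>l=1..nspl (S k) - 2. if r = eta S (k-1) + l \<and> ?c = mu S (k-1) + l then 1 else 0) =
      (if k = i then \<Sum>l=1..nspl (S i) - 2. if l = j then
          (if r = eta S (i-1) + j then 1 else 0 :: real) else 0 else 0)"
    proof (cases "k = i")
      case True
      show ?thesis
        unfolding if_P[OF True] unfolding True by (intro sum.cong refl) auto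
    next
      case False
      then have "\<not> (r = eta S (k-1) + l \<and> ?c = mu S (k-1) + l)" if "l \<in> {1..nspl (S k) - 2}" for l
        using uniq[OF k, of l] that by force
      then show ?thesis using False by (auto intro!: sum.neutral)
    qed
  qed
  also have "\<dots> = (if r = eta S (i-1) + j then 1 else 0)" using i j by simp
  finally have 1: "(\<Sum>k=1..m. \<Sum>l=1..nspl (S k) - 2.
      if r = eta S (k-1) + l \<and> ?c = mu S (k-1) + l then 1 else 0) =
      (if r = eta S (i-1) + j then 1 else 0 :: real)" .
  have "?c \<notin> {mu S k - 1, mu S k}" if k: "k \<in> {1..m-1}" for k
  proof
    assume "?c \<in> {mu S k - 1, mu S k}"
    moreover have k': "k \<in> {1..m}" using k by auto
    ultimately obtain l where l: "l \<in> {1..nspl (S k)}" "nspl (S k) - 2 < l" "?c = mu S (k-1) + l"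
      by (elim last_two_indices[rotated])
    then have "k = i \<and> l = j" using k' by (intro uniq)
    then show False using l(2) j by simp
  qed
  then show ?thesis unfolding Hc_def 1 by (auto intro!: sum.neutral)
qed

lemma Hc_junction:
  assumes i: "i \<in> {1..<m}" and c: "c \<in> {mu S i - 1, mu S i}"
  shows "Hc m S r c = junction i (eta S i) (eta S i + 1) r"
proof -
  have i': "i \<in> {1..m}" using i by simp
  obtain j where j: "j \<in> {1..nspl (S i)}" "nspl (S i) - 2 < j" "c = mu S (i-1) + j"
    using i' c by (rule last_two_indices)
  have "(\<Sum>k=1..m. \<Sum>l=1..nspl (S k) - 2.
      if r = eta S (k-1) + l \<and> c = mu S (k-1) + l then 1 else 0 :: real) = 0"
  proof (intro sum.neutral ballI)
    fix k l assume "k \<in> {1..m}" "l \<in> {1..nspl (S k) - 2}"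
    then show "(if r = eta S (k-1) + l \<and> c = mu S (k-1) + l then 1 else 0 :: real) = 0"
      using mu_index_unique[of i k j l] i j by force
  qed
  moreover have "c \<in> {mu S k - 1, mu S k} \<longleftrightarrow> k = i" if k: "k \<in> {1..m-1}" for k
  proof
    assume "c \<in> {mu S k - 1, mu S k}"
    moreover have "k \<in> {1..m}" using k by auto
    ultimately obtain l where l: "l \<in> {1..nspl (S k)}" "c = mu S (k-1) + l"
      by (elim last_two_indices[rotated])
    have "i = k \<and> j = l"
      using i k j(3) l(2) by (intro mu_index_unique j(1) l(1)) auto
    then show "k = i" by simp
  qed (use c in simp)
  then have "(\<Sum>k=1..m-1.
        (if r = eta S k \<and> c \<in> {mu S k - 1, mu S k}
         then alpha S k / (alpha S k + beta m S k) else 0) +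
        (if r = eta S k + 1 \<and> c \<in> {mu S k - 1, mu S k}
         then beta m S k / (alpha S k + beta m S k) else 0)) =
     (\<Sum>k=1..m-1. if k = i then junction i (eta S i) (eta S i + 1) r else 0)"
    by (intro sum.cong refl) (simp add: junction_def)
  ultimately show ?thesis unfolding Hc_def using i by auto
qed

text \<open>
  The functions of the local basis that vanish at both ends of their segment have unit columns in both
  matrices. The others have the value one at one side of a junction, where their columns are junction
  columns, or at an end of \<open>\<Omega>\<close>, where the two matrices differ.
\<close>

lemma basis_index_cases:
  assumes "k \<in> {1..mu S m}"
  obtains (inner) i j where "i \<in> {1..m}" "j \<in> {1..nspl (S i) - 2}" "k = mu S (i-1) + j + 1"
    | (before) i where "i \<in> {1..<m}" "k = mu S i"
    | (after) i where "i \<in> {1..<m}" "k = mu S i + 1"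
    | (first) "k = 1"
    | (last) "k = mu S m"
proof -
  obtain i j where ij: "i \<in> {1..m}" "j \<in> {1..nspl (S i)}" "k = mu S (i-1) + j"
    using assms by (rule mu_index_obtain)
  have step: "mu S i = mu S (i-1) + nspl (S i)" using mu_step[of i S] ij by simp
  have mu0: "mu S 0 = 0" by (simp add: mu_def)
  consider "j = 1" "i = 1" | "j = 1" "i > 1" | "j = nspl (S i)" "i = m" | "j = nspl (S i)" "i < m"
    | "j \<in> {2..nspl (S i) - 1}"
    using ij by force
  then show ?thesis
  proof cases
    case 1
    then show ?thesis using ij mu0 by (intro first) simp
  next
    case 2
    then show ?thesis using ij by (intro after[of "i-1"]) auto
  next
    case 3
    then show ?thesis using ij step by (intro last) simp
  next
    case 4
    then show ?thesis using ij step by (intro before[of i]) auto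
  next
    case 5
    then show ?thesis using ij by (intro inner[of i "j-1"]) auto
  qed
qed

lemma mu_positions:
  assumes "i \<in> {1..<m}"
  shows "3 \<le> mu S i" "mu S i + 3 \<le> mu S m"
proof -
  show "3 \<le> mu S i" using mu_ge[of i] assms by simp
  have "mu S (Suc i) \<le> mu S m" using assms by (intro mu_mono) simp
  then show "mu S i + 3 \<le> mu S m"
    using mu_step[of "Suc i" S] nspl_ge_3[of "Suc i"] assms by simp
qed

lemma inner_position:
  assumes "i \<in> {1..m}" "j \<in> {1..nspl (S i) - 2}"
  shows "mu S (i-1) + j + 2 \<le> mu S m" "eta S (i-1) + j \<in> {1..eta S m}"
proof -
  have "j + 2 \<le> nspl (S i)" using nspl_ge_3[OF assms(1)] assms(2) by auto
  moreover have "mu S i = mu S (i-1) + nspl (S i)" using mu_step[of i S] assms(1) by simp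
  moreover have "mu S i \<le> mu S m" using assms by (intro mu_mono) simp
  ultimately show "mu S (i-1) + j + 2 \<le> mu S m" by linarith
  have "eta S i \<le> eta S m" using assms by (intro eta_mono) auto
  then show "eta S (i-1) + j \<in> {1..eta S m}"
    using eta_step[OF assms(1)] assms by simp
qed

lemma junction_position:
  assumes "i \<in> {1..<m}"
  shows "1 \<le> eta S i" "eta S i + 1 \<le> eta S m"
  using eta_less[of 0 i] eta_less[of i m] assms by auto

lemma segment_ends:
  assumes i: "i \<in> {1..m}"
  shows "mu S i - 1 = mu S (i-1) + (nspl (S i) - 2) + 1"
    and "eta S (i-1) + (nspl (S i) - 2) = eta S i"
    and "nspl (S i) - 2 \<in> {1..nspl (S i) - 2}"
  using mu_step[of i S] eta_step[OF i] nspl_ge_3[OF i] i by auto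

text \<open>
  Against \<^const>\<open>Hc\<close>, the columns of both matrices are shifted by one position.
\<close>

lemma H_per_inner:
  assumes "i \<in> {1..m}" "j \<in> {1..nspl (S i) - 2}"
  shows "H_per m S r (mu S (i-1) + j + 1) = (if r = eta S (i-1) + j then 1 else 0)"
  using inner_position[OF assms] Hc_inner[OF assms, of r] assms by (simp add: H_per_def)

lemma H_per_junction:
  assumes "i \<in> {1..<m}" "k \<in> {mu S i, mu S i + 1}"
  shows "H_per m S r k = junction i (eta S i) (eta S i + 1) r"
proof -
  have "k \<noteq> 1" "k \<noteq> mu S m" "k - 1 \<in> {mu S i - 1, mu S i}"
    using mu_positions[OF assms(1)] assms(2) by auto
  then show ?thesis using Hc_junction[OF assms(1), of "k-1" r] by (simp add: H_per_def)
qed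

lemma H_per_end:
  assumes "k = 1 \<or> k = mu S m"
  shows "H_per m S r k = junction m (eta S m) 1 r"
  using assms by (simp add: H_per_def h_col_def junction_def n_per_def)

lemma H_full_middle:
  "k \<in> {2..mu S m - 1} \<Longrightarrow>
     H_full m S r k = (if r \<in> {2..n_full m S - 1} then Hc m S (r-1) (k-1) else 0)"
  by (auto simp: H_full_def)

text \<open>
  In the non-periodic matrix the rows are shifted by one as well, because of the first diagonal block.
\<close>

lemma H_full_inner:
  assumes "i \<in> {1..m}" "j \<in> {1..nspl (S i) - 2}" "r \<ge> 1"
  shows "H_full m S r (mu S (i-1) + j + 1) = (if r = eta S (i-1) + j + 1 then 1 else 0)"
proof -
  have "mu S (i-1) + j + 1 \<in> {2..mu S m - 1}"
    using inner_position(1)[OF assms(1,2)] assms(2) by auto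
  then have "H_full m S r (mu S (i-1) + j + 1) =
      (if r \<in> {2..n_full m S - 1} then Hc m S (r-1) (mu S (i-1) + j) else 0)"
    by (subst H_full_middle) simp_all
  also have "\<dots> = (if r \<in> {2..n_full m S - 1} then if r - 1 = eta S (i-1) + j then 1 else 0 else 0)"
    by (simp only: Hc_inner[OF assms(1,2)])
  also have "\<dots> = (if r = eta S (i-1) + j + 1 then 1 else 0)"
    using inner_position(2)[OF assms(1,2)] assms(3) by (auto simp: n_full_def)
  finally show ?thesis .
qed

lemma H_full_junction:
  assumes "i \<in> {1..<m}" "k \<in> {mu S i, mu S i + 1}" "r \<ge> 1"
  shows "H_full m S r k = junction i (eta S i + 1) (eta S i + 2) r"
proof -
  have k: "k \<in> {2..mu S m - 1}" "k - 1 \<in> {mu S i - 1, mu S i}"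
    using mu_positions[OF assms(1)] assms(2) by auto
  have "H_full m S r k =
      (if r \<in> {2..n_full m S - 1} then junction i (eta S i) (eta S i + 1) (r-1) else 0)"
    by (simp only: H_full_middle[OF k(1)] Hc_junction[OF assms(1) k(2)])
  also have "\<dots> = junction i (eta S i + 1) (eta S i + 2) r"
    using junction_position[OF assms(1)] assms(3) by (auto simp: junction_def n_full_def)
  finally show ?thesis .
qed

lemma H_full_first:
  "H_full m S r 1 = (if r = 1 then 1 else 0)"
  using mu_ge[of m] segments by (auto simp: H_full_def)

lemma H_full_last:
  "H_full m S r (mu S m) = (if r = n_full m S then 1 else 0)"
  using mu_ge[of m] segments by (auto simp: H_full_def)

lemma H_full_smooth:
  assumes r: "r \<in> {1..n_full m S}"
  shows "smooth_coeffs (H_full m S r)"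
  unfolding smooth_coeffs_def
proof
  fix i assume i: "i \<in> {1..<m}"
  then have i': "i \<in> {1..m}" "i + 1 \<in> {1..m}" by auto
  have r1: "r \<ge> 1" using r by simp
  have "H_full m S r (mu S i) = junction i (eta S i + 1) (eta S i + 2) r"
    "H_full m S r (mu S i + 1) = junction i (eta S i + 1) (eta S i + 2) r"
    by (rule H_full_junction[OF i _ r1], simp)+
  moreover have "H_full m S r (mu S i - 1) = (if r = eta S i + 1 then 1 else 0)"
    using H_full_inner[OF i'(1) segment_ends(3)[OF i'(1)] r1] segment_ends[OF i'(1)] by simp
  moreover have "H_full m S r (mu S i + 2) = (if r = eta S i + 2 then 1 else 0)"
    using H_full_inner[OF i'(2) _ r1, of 1] nspl_ge_3[OF i'(2)] by simp
  ultimately show "H_full m S r (mu S i) = H_full m S r (mu S i + 1) \<and>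
     alpha S i * (H_full m S r (mu S i) - H_full m S r (mu S i - 1)) =
     beta m S i * (H_full m S r (mu S i + 2) - H_full m S r (mu S i + 1))"
    using junction_balance[OF i'(1)] by simp
qed

lemma H_per_smooth: "smooth_coeffs (H_per m S r)"
  unfolding smooth_coeffs_def
proof
  fix i assume i: "i \<in> {1..<m}"
  then have i': "i \<in> {1..m}" "i + 1 \<in> {1..m}" by auto
  have "H_per m S r (mu S i) = junction i (eta S i) (eta S i + 1) r"
    "H_per m S r (mu S i + 1) = junction i (eta S i) (eta S i + 1) r"
    by (rule H_per_junction[OF i], simp)+
  moreover have "H_per m S r (mu S i - 1) = (if r = eta S i then 1 else 0)"
    using H_per_inner[OF i'(1) segment_ends(3)[OF i'(1)]] segment_ends[OF i'(1)] by simp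
  moreover have "H_per m S r (mu S i + 2) = (if r = eta S i + 1 then 1 else 0)"
    using H_per_inner[OF i'(2), of 1] nspl_ge_3[OF i'(2)] by simp
  ultimately show "H_per m S r (mu S i) = H_per m S r (mu S i + 1) \<and>
     alpha S i * (H_per m S r (mu S i) - H_per m S r (mu S i - 1)) =
     beta m S i * (H_per m S r (mu S i + 2) - H_per m S r (mu S i + 1))"
    using junction_balance[OF i'(1)] by simp
qed

lemma H_per_periodic: "periodic_coeffs (H_per m S r)"
proof -
  have m1: "1 \<in> {1..m}" "m \<in> {1..m}" using segments by auto
  have e: "mu S 0 = 0" "eta S 0 = 0" by (simp_all add: mu_def eta_def)
  have "H_per m S r (mu S m) = junction m (eta S m) 1 r" "H_per m S r 1 = junction m (eta S m) 1 r"
    by (simp_all add: H_per_end)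
  moreover have "H_per m S r (mu S m - 1) = (if r = eta S m then 1 else 0)"
    using H_per_inner[OF m1(2) segment_ends(3)[OF m1(2)]] segment_ends[OF m1(2)] by simp
  moreover have "H_per m S r 2 = (if r = 1 then 1 else 0)"
    using H_per_inner[OF m1(1), of 1 r] nspl_ge_3[OF m1(1)] by (simp add: e numeral_2_eq_2)
  ultimately show ?thesis using junction_balance[OF m1(2)] by (simp add: periodic_coeffs_def)
qed

lemma eta_pos: "1 \<le> eta S m"
  using eta_less[of 0 m] segments by simp

lemma H_full_nonneg:
  assumes "r \<in> {1..n_full m S}" and k: "k \<in> {1..mu S m}"
  shows "H_full m S r k \<ge> 0"
proof -
  have r: "r \<ge> 1" using assms(1) by simp
  from k show ?thesis
  proof (cases rule: basis_index_cases)
    case (inner i j)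
    then show ?thesis using H_full_inner[OF inner(1,2) r] by simp
  next
    case (before i)
    then show ?thesis using H_full_junction[OF before(1) _ r, of k] by (simp add: junction_nonneg)
  next
    case (after i)
    then show ?thesis using H_full_junction[OF after(1) _ r, of k] by (simp add: junction_nonneg)
  qed (simp_all add: H_full_first[simplified] H_full_last)
qed

lemma H_per_nonneg:
  assumes k: "k \<in> {1..mu S m}"
  shows "H_per m S r k \<ge> 0"
  using k
proof (cases rule: basis_index_cases)
  case (inner i j)
  then show ?thesis using H_per_inner[OF inner(1,2), of r] by simp
next
  case (before i)
  then show ?thesis using H_per_junction[OF before(1), of k r] by (simp add: junction_nonneg)
next
  case (after i)
  then show ?thesis using H_per_junction[OF after(1), of k r] by (simp add: junction_nonneg)
qed (use segments in \<open>simp_all add: H_per_end junction_nonneg\<close>)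

lemma H_full_col_sum:
  assumes k: "k \<in> {1..mu S m}"
  shows "(\<Sum>r=1..n_full m S. H_full m S r k) = 1"
proof -
  have junction: ?thesis if "i \<in> {1..<m}" "k \<in> {mu S i, mu S i + 1}" for i
  proof -
    have "(\<Sum>r=1..n_full m S. H_full m S r k) =
        (\<Sum>r=1..n_full m S. junction i (eta S i + 1) (eta S i + 2) r)"
      using that by (intro sum.cong refl H_full_junction) auto
    also have "\<dots> = 1"
      using junction_position[OF that(1)] that(1) by (intro junction_sum) (auto simp: n_full_def)
    finally show ?thesis .
  qed
  have 1: "1 \<in> {1..n_full m S}" "n_full m S \<in> {1..n_full m S}" by (simp_all add: n_full_def)
  from k show ?thesis
  proof (cases rule: basis_index_cases)
    case (inner i j)
    have "(\<Sum>r=1..n_full m S. H_full m S r k) =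
        (\<Sum>r=1..n_full m S. if r = eta S (i-1) + j + 1 then 1 else 0)"
      unfolding inner(3) using inner by (intro sum.cong refl H_full_inner) auto
    also have "eta S (i-1) + j + 1 \<in> {1..n_full m S}"
      using inner_position(2)[OF inner(1,2)] by (auto simp: n_full_def)
    then have "(\<Sum>r=1..n_full m S. if r = eta S (i-1) + j + 1 then 1 else 0 :: real) = 1"
      by (subst sum.delta) auto
    finally show ?thesis .
  next
    case (before i)
    then show ?thesis by (intro junction[of i]) auto
  next
    case (after i)
    then show ?thesis by (intro junction[of i]) auto
  next
    case first
    then show ?thesis using 1(1) by (simp only: H_full_first) (subst sum.delta; auto)
  next
    case last
    then show ?thesis using 1(2) by (simp only: H_full_last) (subst sum.delta; auto)
  qed
qed

lemma H_per_col_sum: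
  assumes k: "k \<in> {1..mu S m}"
  shows "(\<Sum>r=1..n_per m S. H_per m S r k) = 1"
proof -
  have junction: ?thesis if "i \<in> {1..<m}" "k \<in> {mu S i, mu S i + 1}" for i
  proof -
    have "(\<Sum>r=1..n_per m S. H_per m S r k) =
        (\<Sum>r=1..n_per m S. junction i (eta S i) (eta S i + 1) r)"
      using that by (intro sum.cong refl H_per_junction) auto
    also have "\<dots> = 1"
      using junction_position[OF that(1)] that(1) by (intro junction_sum) (auto simp: n_per_def)
    finally show ?thesis .
  qed
  have ends: ?thesis if "k = 1 \<or> k = mu S m"
  proof -
    have "(\<Sum>r=1..n_per m S. H_per m S r k) = (\<Sum>r=1..n_per m S. junction m (eta S m) 1 r)"
      using that by (intro sum.cong refl H_per_end)
    also have "\<dots> = 1"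
      using segments eta_pos by (intro junction_sum) (auto simp: n_per_def)
    finally show ?thesis .
  qed
  from k show ?thesis
  proof (cases rule: basis_index_cases)
    case (inner i j)
    have "(\<Sum>r=1..n_per m S. H_per m S r k) =
        (\<Sum>r=1..n_per m S. if r = eta S (i-1) + j then 1 else 0)"
      unfolding inner(3) using inner by (intro sum.cong refl H_per_inner) auto
    also have "\<dots> = 1"
      using inner_position(2)[OF inner(1,2)] by (subst sum.delta) (auto simp: n_per_def)
    finally show ?thesis .
  next
    case (before i)
    then show ?thesis by (intro junction[of i]) auto
  next
    case (after i)
    then show ?thesis by (intro junction[of i]) auto
  qed (use ends in auto)
qed

lemma H_full_pivot:
  assumes r: "r \<in> {1..n_full m S}"
  shows "\<exists>k\<in>{1..mu S m}. \<forall>r'\<in>{1..n_full m S}. H_full m S r' k = (if r' = r then 1 else 0)"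
proof -
  have mu1: "1 \<in> {1..mu S m}" "mu S m \<in> {1..mu S m}" using mu_ge[of m] segments by auto
  consider "r = 1" | "r = n_full m S" | "r - 1 \<in> {1..eta S m}" "r = r - 1 + 1"
    using r by (force simp: n_full_def)
  then show ?thesis
  proof cases
    case 1
    then show ?thesis using mu1 H_full_first by blast
  next
    case 2
    then show ?thesis using mu1 H_full_last by blast
  next
    case 3
    from 3(1) obtain i j where ij: "i \<in> {1..m}" "j \<in> {1..nspl (S i) - 2}" "r - 1 = eta S (i-1) + j"
      by (rule eta_index_obtain)
    have "mu S (i-1) + j + 1 \<in> {1..mu S m}" using inner_position(1)[OF ij(1,2)] by simp
    moreover have "\<forall>r'\<in>{1..n_full m S}. H_full m S r' (mu S (i-1) + j + 1) = (if r' = r then 1 else 0)"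
      using H_full_inner[OF ij(1,2)] ij(3) 3(2) by auto
    ultimately show ?thesis by blast
  qed
qed

lemma H_per_pivot:
  assumes r: "r \<in> {1..n_per m S}"
  shows "\<exists>k\<in>{1..mu S m}. \<forall>r'\<in>{1..n_per m S}. H_per m S r' k = (if r' = r then 1 else 0)"
proof -
  from r obtain i j where ij: "i \<in> {1..m}" "j \<in> {1..nspl (S i) - 2}" "r = eta S (i-1) + j"
    unfolding n_per_def by (rule eta_index_obtain)
  have "mu S (i-1) + j + 1 \<in> {1..mu S m}" using inner_position(1)[OF ij(1,2)] by simp
  moreover have "\<forall>r'\<in>{1..n_per m S}. H_per m S r' (mu S (i-1) + j + 1) = (if r' = r then 1 else 0)"
    using H_per_inner[OF ij(1,2)] ij(3) by auto
  ultimately show ?thesis by blast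
qed

end

theorem theorem2p2:
  fixes m :: nat and S :: "nat \<Rightarrow> segment" and \<tau> :: real
  assumes "m \<ge> 1"
    and "\<forall>i\<in>{1..m}. valid_segment (S i)"
  shows "(\<forall>i\<in>{1..n_full m S}. B_full m S \<tau> i \<in> spline_space m S \<tau>) \<and>
         (\<forall>i\<in>{1..n_per m S}. B_per m S \<tau> i \<in> per_spline_space m S \<tau>) \<and>
         lin_indep_on (Omega m S \<tau>) (n_full m S) (B_full m S \<tau>) \<and>
         locally_supported_on (Omega m S \<tau>) (n_full m S) (mu S m) (H_full m S)
           (local_basis m S \<tau>) (B_full m S \<tau>) \<and>
         convex_partition_of_unity_on (Omega m S \<tau>) (n_full m S) (B_full m S \<tau>) \<and>
         lin_indep_on (Omega m S \<tau>) (n_per m S) (B_per m S \<tau>) \<and>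
         locally_supported_on (Omega m S \<tau>) (n_per m S) (mu S m) (H_per m S)
           (local_basis m S \<tau>) (B_per m S \<tau>) \<and>
         convex_partition_of_unity_on (Omega m S \<tau>) (n_per m S) (B_per m S \<tau>)"
proof -
  interpret multi_segment m S \<tau> using assms by unfold_locales
  have full: "B_full m S \<tau> r = combination (H_full m S r)" for r
    by (rule ext) (simp add: B_full_def combination_def)
  have per: "B_per m S \<tau> r = combination (H_per m S r)" for r
    by (rule ext) (simp add: B_per_def combination_def)
  note F = spline_family_properties[OF H_full_smooth H_full_nonneg H_full_col_sum H_full_pivot full]
  note P = spline_family_properties[OF H_per_smooth H_per_nonneg H_per_col_sum H_per_pivot per]
  show ?thesis
    by (intro conjI ballI F(1,3,4,5) P(2,3,4,5) H_per_periodic; assumption)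
qed

end
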